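(* Let $\phi:R\rightarrow S$ be a homomorphism of commutative rings, let $\phi^{\ast}:\operatorname{Spec}(S)\rightarrow\operatorname{Spec}(R)$, $\mathfrak{q}\mapsto\phi^{-1}(\mathfrak{q})$, be the induced map, and let $X=\operatorname{Im}\phi^{\ast}$. Let $M$ be a finitely generated flat $R$-module. Assume there exists some $n\geq1$ such that $\bigcap_{\mathfrak{p}\in X^{(n)}}\mathfrak{p}$ is contained in the Jacobson radical of $R$. If $M\otimes_{R}S$ is a projective $S$-module, then $M$ is a projective $R$-module.
   Context: All rings are commutative (with identity), and ring maps are unital. For a subset $X\subseteq\operatorname{Spec}(R)$, put $X_{s}:=\bigcup_{\mathfrak{p}\in X}\{\mathfrak{q}\in\operatorname{Spec}(R):\mathfrak{p}\subseteq\mathfrak{q}\}$ (the specialization cone) and $X_{g}:=\bigcup_{\mathfrak{p}\in X}\{\mathfrak{q}\in\operatorname{Spec}(R):\mathfrak{q}\subseteq\mathfrak{p}\}$ (the generalization cone). Define $X^{(1)}:=(X_{s})_{g}$ and inductively $X^{(n)}:=(X^{(n-1)})^{(1)}$ for $n\geq 2$. An intersection of ideals of $R$ over the empty index set is $R$. *)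

theory Defs
  imports "HOL-Algebra.Ideal" "HOL-Algebra.Module" "HOL-Algebra.Free_Abelian_Groups"
begin

section \<open>The prime spectrum\<close>

definition Spec :: "('r, 'a) ring_scheme \<Rightarrow> 'r set set" where
  "Spec R = {p. primeideal p R}"

definition spec_map ::
    "('r, 'a) ring_scheme \<Rightarrow> ('s, 'b) ring_scheme \<Rightarrow> ('r \<Rightarrow> 's) \<Rightarrow> 's set \<Rightarrow> 'r set" where
  "spec_map R S \<phi> q = {x \<in> carrier R. \<phi> x \<in> q}"

definition specialization_cone :: "('r, 'a) ring_scheme \<Rightarrow> 'r set set \<Rightarrow> 'r set set" where
  "specialization_cone R X = (\<Union>p\<in>X. {q \<in> Spec R. p \<subseteq> q})"

definition generalization_cone :: "('r, 'a) ring_scheme \<Rightarrow> 'r set set \<Rightarrow> 'r set set" where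
  "generalization_cone R X = (\<Union>p\<in>X. {q \<in> Spec R. q \<subseteq> p})"

text \<open>The set \<open>X\<^bsup>(n)\<^esup>\<close> for \<open>n \<ge> 1\<close>; the value at \<open>n = 0\<close> is \<open>X\<close> itself.\<close>

definition iterated_cone :: "('r, 'a) ring_scheme \<Rightarrow> nat \<Rightarrow> 'r set set \<Rightarrow> 'r set set" where
  "iterated_cone R n = (\<lambda>X. generalization_cone R (specialization_cone R X)) ^^ n"

text \<open>Intersecting with the carrier only matters for the empty family, whose intersection is \<open>R\<close>.\<close>

definition ideal_Inter :: "('r, 'a) ring_scheme \<Rightarrow> 'r set set \<Rightarrow> 'r set" where
  "ideal_Inter R X = carrier R \<inter> \<Inter>X"

definition jacobson_radical :: "('r, 'a) ring_scheme \<Rightarrow> 'r set" where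
  "jacobson_radical R = ideal_Inter R {m. maximalideal m R}"


section \<open>Linear maps, finitely generated and projective modules\<close>

definition mod_hom ::
    "('r, 'a) ring_scheme \<Rightarrow> ('r, 'm, 'b) module_scheme \<Rightarrow> ('r, 'n, 'c) module_scheme \<Rightarrow> ('m \<Rightarrow> 'n) set" where
  "mod_hom R M N = {f \<in> carrier M \<rightarrow> carrier N.
     (\<forall>x\<in>carrier M. \<forall>y\<in>carrier M. f (x \<oplus>\<^bsub>M\<^esub> y) = f x \<oplus>\<^bsub>N\<^esub> f y) \<and>
     (\<forall>r\<in>carrier R. \<forall>x\<in>carrier M. f (r \<odot>\<^bsub>M\<^esub> x) = r \<odot>\<^bsub>N\<^esub> f x)}"

definition finitely_generated_module ::
    "('r, 'a) ring_scheme \<Rightarrow> ('r, 'm, 'b) module_scheme \<Rightarrow> bool" where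
  "finitely_generated_module R M \<longleftrightarrow> module R M \<and>
     (\<exists>A. finite A \<and> A \<subseteq> carrier M \<and>
        (\<forall>x\<in>carrier M. \<exists>c \<in> A \<rightarrow> carrier R. x = (\<Oplus>\<^bsub>M\<^esub>a\<in>A. c a \<odot>\<^bsub>M\<^esub> a)))"

text \<open>
  A definition in HOL cannot quantify over all modules, since these live on arbitrary types.
  The notions below therefore carry the element types \<open>'u\<close>, \<open>'v\<close> of the test modules as
  parameters. \<open>P\<close> is projective iff every \<open>R\<close>-linear map from \<open>P\<close> to \<open>N'\<close> lifts along every
  surjection \<open>N \<rightarrow> N'\<close>. As a conclusion this is stated for all \<open>'u\<close>, \<open>'v\<close>. As a hypothesis on
  \<open>P\<close> with elements of type \<open>'p\<close> over a ring with elements of type \<open>'r\<close>, the types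
  \<open>'u = ('p \<Rightarrow> 'r)\<close> and \<open>'v = 'p\<close> are enough: they cover the surjection onto \<open>P\<close> from the free
  module on the set \<open>P\<close>, and its splitting makes \<open>P\<close> a direct summand of a free module.
\<close>

definition projective_module ::
    "'u itself \<Rightarrow> 'v itself \<Rightarrow> ('r, 'a) ring_scheme \<Rightarrow> ('r, 'p, 'b) module_scheme \<Rightarrow> bool" where
  "projective_module TYPE('u) TYPE('v) R P \<longleftrightarrow> module R P \<and>
     (\<forall>(N :: ('r, 'u) module) (N' :: ('r, 'v) module) g f.
        module R N \<longrightarrow> module R N' \<longrightarrow>
        g \<in> mod_hom R N N' \<longrightarrow> g ` carrier N = carrier N' \<longrightarrow> f \<in> mod_hom R P N' \<longrightarrow>
        (\<exists>h \<in> mod_hom R P N. \<forall>x\<in>carrier P. g (h x) = f x))"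


section \<open>Tensor products\<close>

text \<open>
  The tensor product of two \<open>R\<close>-modules is the free abelian group on pairs modulo the usual
  relations; its elements are cosets of formal integer combinations of pairs.
\<close>

type_synonym ('m, 'n) tensor = "('m \<times> 'n \<Rightarrow>\<^sub>0 int) set"

definition tensor_free ::
    "('r, 'm, 'b) module_scheme \<Rightarrow> ('r, 'n, 'c) module_scheme \<Rightarrow> ('m \<times> 'n \<Rightarrow>\<^sub>0 int) monoid" where
  "tensor_free M N = free_Abelian_group (carrier M \<times> carrier N)"

definition tensor_rel ::
    "('r, 'a) ring_scheme \<Rightarrow> ('r, 'm, 'b) module_scheme \<Rightarrow> ('r, 'n, 'c) module_scheme
      \<Rightarrow> ('m \<times> 'n \<Rightarrow>\<^sub>0 int) set" where
  "tensor_rel R M N = generate (tensor_free M N)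
     ({frag_of (x \<oplus>\<^bsub>M\<^esub> x', y) - frag_of (x, y) - frag_of (x', y) | x x' y.
         x \<in> carrier M \<and> x' \<in> carrier M \<and> y \<in> carrier N} \<union>
      {frag_of (x, y \<oplus>\<^bsub>N\<^esub> y') - frag_of (x, y) - frag_of (x, y') | x y y'.
         x \<in> carrier M \<and> y \<in> carrier N \<and> y' \<in> carrier N} \<union>
      {frag_of (r \<odot>\<^bsub>M\<^esub> x, y) - frag_of (x, r \<odot>\<^bsub>N\<^esub> y) | r x y.
         r \<in> carrier R \<and> x \<in> carrier M \<and> y \<in> carrier N})"

definition tensor_group ::
    "('r, 'a) ring_scheme \<Rightarrow> ('r, 'm, 'b) module_scheme \<Rightarrow> ('r, 'n, 'c) module_scheme
      \<Rightarrow> ('m, 'n) tensor monoid" where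
  "tensor_group R M N = tensor_free M N Mod tensor_rel R M N"

text \<open>The map \<open>g \<otimes> h : M \<otimes> N \<rightarrow> M' \<otimes> N'\<close>. For \<open>R\<close>-linear \<open>g\<close> and \<open>h\<close> all cosets in the union agree.\<close>

definition tensor_push :: "('m \<Rightarrow> 'm1) \<Rightarrow> ('n \<Rightarrow> 'n1) \<Rightarrow> ('m \<times> 'n \<Rightarrow>\<^sub>0 int) \<Rightarrow> ('m1 \<times> 'n1 \<Rightarrow>\<^sub>0 int)" where
  "tensor_push g h = frag_extend (\<lambda>(x, y). frag_of (g x, h y))"

definition tensor_map ::
    "('r, 'a) ring_scheme \<Rightarrow> ('r, 'm1, 'b) module_scheme \<Rightarrow> ('r, 'n1, 'c) module_scheme
      \<Rightarrow> ('m \<Rightarrow> 'm1) \<Rightarrow> ('n \<Rightarrow> 'n1) \<Rightarrow> ('m, 'n) tensor \<Rightarrow> ('m1, 'n1) tensor" where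
  "tensor_map R M' N' g h C =
     (\<Union>c\<in>C. tensor_rel R M' N' #>\<^bsub>tensor_free M' N'\<^esub> tensor_push g h c)"

text \<open>
  \<open>M\<close> is flat iff \<open>M \<otimes> _\<close> preserves injectivity of linear maps. For a ring with elements of type
  \<open>'r\<close>, test modules with \<open>'u = 'v = 'r\<close> include the inclusions of ideals into \<open>R\<close>, which
  suffice by the ideal criterion for flatness.
\<close>

definition flat_module ::
    "'u itself \<Rightarrow> 'v itself \<Rightarrow> ('r, 'a) ring_scheme \<Rightarrow> ('r, 'm, 'b) module_scheme \<Rightarrow> bool" where
  "flat_module TYPE('u) TYPE('v) R M \<longleftrightarrow> module R M \<and>
     (\<forall>(N :: ('r, 'u) module) (N' :: ('r, 'v) module) i.
        module R N \<longrightarrow> module R N' \<longrightarrow>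
        i \<in> mod_hom R N N' \<longrightarrow> inj_on i (carrier N) \<longrightarrow>
        inj_on (tensor_map R M N' (\<lambda>x. x) i) (carrier (tensor_group R M N)))"


section \<open>Base change along a ring homomorphism\<close>

definition restrict_scalars :: "('s, 'b) ring_scheme \<Rightarrow> ('r \<Rightarrow> 's) \<Rightarrow> ('r, 's) module" where
  "restrict_scalars S \<phi> = \<lparr>carrier = carrier S, monoid.mult = mult S, one = one S, ring.zero = \<zero>\<^bsub>S\<^esub>,
     ring.add = add S, smult = (\<lambda>r s. \<phi> r \<otimes>\<^bsub>S\<^esub> s)\<rparr>"

text \<open>
  \<open>M \<otimes>\<^sub>R S\<close> with \<open>s\<close> acting as \<open>id \<otimes> (s \<otimes>\<^bsub>S\<^esub> _)\<close>. The fields \<open>mult\<close> and \<open>one\<close>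
  of a module record are not used by the locale \<open>module\<close>.
\<close>

definition base_change ::
    "('r, 'a) ring_scheme \<Rightarrow> ('s, 'b) ring_scheme \<Rightarrow> ('r \<Rightarrow> 's) \<Rightarrow> ('r, 'm, 'c) module_scheme
      \<Rightarrow> ('s, ('m, 's) tensor) module" where
  "base_change R S \<phi> M = (let S' = restrict_scalars S \<phi>; T = tensor_group R M S' in
     \<lparr>carrier = carrier T, mult = undefined, one = undefined, ring.zero = one T, ring.add = mult T,
      smult = (\<lambda>s. tensor_map R M S' (\<lambda>x. x) (\<lambda>t. s \<otimes>\<^bsub>S\<^esub> t))\<rparr>)"

section \<open>Base change yields a module\<close>

lemma tensor_free_simps [simp]:
  "carrier (tensor_free M N) = {c. Poly_Mapping.keys c \<subseteq> carrier M \<times> carrier N}"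
  "mult (tensor_free M N) = (+)" "one (tensor_free M N) = 0"
  by (auto simp: tensor_free_def free_Abelian_group_def)

lemma tensor_free_group: "comm_group (tensor_free M N)"
  by (simp add: tensor_free_def abelian_free_Abelian_group)

lemma tensor_free_gens:
  assumes "module R M" "module R N"
  shows "{frag_of (x \<oplus>\<^bsub>M\<^esub> x', y) - frag_of (x, y) - frag_of (x', y) | x x' y.
         x \<in> carrier M \<and> x' \<in> carrier M \<and> y \<in> carrier N} \<union>
      {frag_of (x, y \<oplus>\<^bsub>N\<^esub> y') - frag_of (x, y) - frag_of (x, y') | x y y'.
         x \<in> carrier M \<and> y \<in> carrier N \<and> y' \<in> carrier N} \<union>
      {frag_of (r \<odot>\<^bsub>M\<^esub> x, y) - frag_of (x, r \<odot>\<^bsub>N\<^esub> y) | r x y.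
         r \<in> carrier R \<and> x \<in> carrier M \<and> y \<in> carrier N} \<subseteq> carrier (tensor_free M N)"
proof -
  interpret M: module R M by fact
  interpret N: module R N by fact
  show ?thesis
    by (fastforce simp: keys_frag_of dest!: subsetD[OF keys_diff])
qed

lemma tensor_rel_subgroup:
  assumes "module R M" "module R N"
  shows "subgroup (tensor_rel R M N) (tensor_free M N)"
  unfolding tensor_rel_def
  by (rule group.generate_is_subgroup) (use tensor_free_group comm_group.axioms(2) tensor_free_gens[OF assms] in blast)+

lemma tensor_rel_closed:
  assumes "module R M" "module R N"
  shows "0 \<in> tensor_rel R M N"
    "a \<in> tensor_rel R M N \<Longrightarrow> b \<in> tensor_rel R M N \<Longrightarrow> a + b \<in> tensor_rel R M N"
    "a \<in> tensor_rel R M N \<Longrightarrow> - a \<in> tensor_rel R M N"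
    "a \<in> tensor_rel R M N \<Longrightarrow> b \<in> tensor_rel R M N \<Longrightarrow> a - b \<in> tensor_rel R M N"
proof -
  note S = tensor_rel_subgroup[OF assms]
  show z: "0 \<in> tensor_rel R M N" using subgroup.one_closed[OF S] by simp
  show p: "a + b \<in> tensor_rel R M N" if "a \<in> tensor_rel R M N" "b \<in> tensor_rel R M N" for a b
    using subgroup.m_closed[OF S that] by simp
  show m: "- a \<in> tensor_rel R M N" if "a \<in> tensor_rel R M N" for a
  proof -
    have "a \<in> carrier (tensor_free M N)" using subgroup.mem_carrier[OF S that] .
    then have "inv\<^bsub>tensor_free M N\<^esub> a = - a" unfolding tensor_free_def by simp
    then show ?thesis using subgroup.m_inv_closed[OF S that] by simp
  qed
  show "a - b \<in> tensor_rel R M N" if "a \<in> tensor_rel R M N" "b \<in> tensor_rel R M N" for a b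
    using p[OF that(1) m[OF that(2)]] by simp
qed

lemma tensor_coset: "tensor_rel R M N #>\<^bsub>tensor_free M N\<^esub> c = {a. a - c \<in> tensor_rel R M N}"
  unfolding r_coset_def by auto

lemma tensor_coset_eq:
  assumes "module R M" "module R N" "a - b \<in> tensor_rel R M N"
  shows "tensor_rel R M N #>\<^bsub>tensor_free M N\<^esub> a = tensor_rel R M N #>\<^bsub>tensor_free M N\<^esub> b"
proof -
  have "(x - a \<in> tensor_rel R M N) = (x - b \<in> tensor_rel R M N)" for x
    using tensor_rel_closed(2,4)[OF assms(1,2) _ assms(3), of "x - a"]
      tensor_rel_closed(4)[OF assms(1,2) _ assms(3), of "x - b"] by auto
  then show ?thesis unfolding tensor_coset by simp
qed

lemma tensor_push_closed:
  assumes "c \<in> carrier (tensor_free M N)" "g \<in> carrier M \<rightarrow> carrier M'" "h \<in> carrier N \<rightarrow> carrier N'"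
  shows "tensor_push g h c \<in> carrier (tensor_free M' N')"
  using assms keys_frag_extend[of "\<lambda>(x, y). frag_of (g x, h y)" c]
  by (fastforce simp: tensor_push_def keys_frag_of)

lemma tensor_push_simps [simp]: "tensor_push g h (a + b) = tensor_push g h a + tensor_push g h b"
  "tensor_push g h (a - b) = tensor_push g h a - tensor_push g h b"
  "tensor_push g h (- a) = - tensor_push g h a" "tensor_push g h 0 = 0"
  "tensor_push g h (frag_of (x,y)) = frag_of (g x, h y)"
  by (simp_all add: tensor_push_def frag_extend_add frag_extend_diff frag_extend_minus)

lemma tensor_rel_gens:
  "x \<in> carrier M \<Longrightarrow> x' \<in> carrier M \<Longrightarrow> y \<in> carrier N \<Longrightarrow> frag_of (x \<oplus>\<^bsub>M\<^esub> x', y) - frag_of (x, y) - frag_of (x', y) \<in> tensor_rel R M N"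
  "x \<in> carrier M \<Longrightarrow> y \<in> carrier N \<Longrightarrow> y' \<in> carrier N \<Longrightarrow> frag_of (x, y \<oplus>\<^bsub>N\<^esub> y') - frag_of (x, y) - frag_of (x, y') \<in> tensor_rel R M N"
  "r \<in> carrier R \<Longrightarrow> x \<in> carrier M \<Longrightarrow> y \<in> carrier N \<Longrightarrow> frag_of (r \<odot>\<^bsub>M\<^esub> x, y) - frag_of (x, r \<odot>\<^bsub>N\<^esub> y) \<in> tensor_rel R M N"
  unfolding tensor_rel_def by (rule generate.incl, blast)+

lemma tensor_push_rel:
  assumes "module R M" "module R N" "module R M'" "module R N'"
    "g \<in> mod_hom R M M'" "h \<in> mod_hom R N N'" "c \<in> tensor_rel R M N"
  shows "tensor_push g h c \<in> tensor_rel R M' N'"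
  using assms(7) unfolding tensor_rel_def[of R M N]
proof (induction rule: generate.induct)
  case one
  then show ?case using tensor_rel_closed assms by simp
next
  case (incl c)
  then show ?case using assms(5,6)
    by (auto simp: mod_hom_def Pi_iff intro!: tensor_rel_gens)
next
  case (inv c)
  then have "c \<in> carrier (tensor_free M N)" using tensor_free_gens[OF assms(1,2)] by (rule rev_subsetD)
  then have "inv\<^bsub>tensor_free M N\<^esub> c = - c" unfolding tensor_free_def by simp
  moreover have "tensor_push g h c \<in> tensor_rel R M' N'" using inv assms(5,6)
    by (auto simp: mod_hom_def Pi_iff intro!: tensor_rel_gens)
  ultimately show ?case using tensor_rel_closed(3)[OF assms(3,4)] by simp
next
  case (eng a b)
  then show ?case using tensor_rel_closed(2)[OF assms(3,4)] by simp
qed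

lemma tensor_map_coset:
  assumes "module R M" "module R N" "module R M'" "module R N'"
    "g \<in> mod_hom R M M'" "h \<in> mod_hom R N N'"
  shows "tensor_map R M' N' g h (tensor_rel R M N #>\<^bsub>tensor_free M N\<^esub> c) =
    tensor_rel R M' N' #>\<^bsub>tensor_free M' N'\<^esub> tensor_push g h c"
proof -
  have "tensor_rel R M' N' #>\<^bsub>tensor_free M' N'\<^esub> tensor_push g h a =
     tensor_rel R M' N' #>\<^bsub>tensor_free M' N'\<^esub> tensor_push g h c"
    if "a \<in> tensor_rel R M N #>\<^bsub>tensor_free M N\<^esub> c" for a
    using tensor_push_rel[OF assms, of "a - c"] that
    by (intro tensor_coset_eq assms) (simp add: tensor_coset)
  moreover have "c \<in> tensor_rel R M N #>\<^bsub>tensor_free M N\<^esub> c"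
    using tensor_rel_closed(1) assms by (simp add: tensor_coset)
  ultimately show ?thesis unfolding tensor_map_def by blast
qed

lemma restrict_scalars_module:
  assumes "cring R" "cring S" "\<phi> \<in> ring_hom R S"
  shows "module R (restrict_scalars S \<phi>)"
proof -
  interpret ring_hom_cring R S \<phi> using assms by (simp add: ring_hom_cring_def ring_hom_cring_axioms_def)
  have "abelian_group (restrict_scalars S \<phi>)"
    by (rule abelian_groupI)
      (auto simp: restrict_scalars_def S.a_ac intro: S.l_neg)
  then show ?thesis
    by (intro moduleI assms) (auto simp: restrict_scalars_def S.l_distr S.r_distr S.m_assoc)
qed

lemma frag_diff_induct:
  assumes "Poly_Mapping.keys c \<subseteq> A" "P 0" "\<And>x. x \<in> A \<Longrightarrow> P (frag_of x)" "\<And>a b. P a \<Longrightarrow> P b \<Longrightarrow> P (a - b)"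
  shows "P c" using frag_induction[of c A P] assms by blast

lemma base_change_module:
  assumes "cring R" "cring S" "\<phi> \<in> ring_hom R S" "module R M"
  shows "module S (base_change R S \<phi> M)"
proof -
  interpret ring_hom_cring R S \<phi> using assms by (simp add: ring_hom_cring_def ring_hom_cring_axioms_def)
  interpret M: module R M by fact
  define S' where "S' = restrict_scalars S \<phi>"
  have S': "module R S'" unfolding S'_def by (rule restrict_scalars_module) fact+
  have S'c [simp]: "carrier S' = carrier S" "add S' = add S" "smult S' = (\<lambda>r s. \<phi> r \<otimes>\<^bsub>S\<^esub> s)"
    by (simp_all add: S'_def restrict_scalars_def)
  let ?F = "tensor_free M S'" and ?K = "tensor_rel R M S'"
  note K = tensor_rel_closed[OF assms(4) S']
  have hom: "(\<lambda>x. x) \<in> mod_hom R M M" "s \<in> carrier S \<Longrightarrow> (\<lambda>t. s \<otimes>\<^bsub>S\<^esub> t) \<in> mod_hom R S' S'" for s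
    by (auto simp: mod_hom_def S.r_distr S.m_lcomm)
  note tm = tensor_map_coset[OF assms(4) S' assms(4) S' hom]
  note sub = tensor_rel_subgroup[OF assms(4) S']
  interpret F: comm_group ?F by (rule tensor_free_group)
  interpret norm: normal ?K ?F using F.normal_iff_subgroup sub by simp
  have cg: "comm_group (?F Mod ?K)" using F.abelian_FactGroup[OF sub] .
  interpret Q: comm_group "?F Mod ?K" by (rule cg)
  have B: "carrier (base_change R S \<phi> M) = (\<lambda>c. ?K #>\<^bsub>?F\<^esub> c) ` carrier ?F"
    "add (base_change R S \<phi> M) = set_mult ?F" "ring.zero (base_change R S \<phi> M) = ?K"
    "smult (base_change R S \<phi> M) = (\<lambda>s. tensor_map R M S' (\<lambda>x. x) (\<lambda>t. s \<otimes>\<^bsub>S\<^esub> t))"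
    by (simp_all add: base_change_def Let_def tensor_group_def carrier_FactGroup flip: S'_def)
  have ab: "abelian_group (base_change R S \<phi> M)"
  proof -
    have T: "carrier (base_change R S \<phi> M) = carrier (?F Mod ?K)"
        "ring.zero (base_change R S \<phi> M) = one (?F Mod ?K)" "ring.add (base_change R S \<phi> M) = mult (?F Mod ?K)"
      by (simp_all add: base_change_def Let_def tensor_group_def flip: S'_def)
    show ?thesis
      by (rule abelian_groupI; unfold T)
        (erule (2) Q.m_assoc | erule (1) Q.m_comm | erule Q.l_one | erule (1) Q.m_closed | rule Q.one_closed
          | rule bexI, erule Q.l_inv, erule Q.inv_closed)+
  qed
  have add: "(?K #>\<^bsub>?F\<^esub> a) <#>\<^bsub>?F\<^esub> (?K #>\<^bsub>?F\<^esub> b) = ?K #>\<^bsub>?F\<^esub> (a + b)"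
    if "a \<in> carrier ?F" "b \<in> carrier ?F" for a b
    using norm.rcos_sum[OF that] by simp
  have pc: "tensor_push (\<lambda>x. x) (\<lambda>t. s \<otimes>\<^bsub>S\<^esub> t) c \<in> carrier ?F" if "c \<in> carrier ?F" "s \<in> carrier S" for s c
    using that(2) by (intro tensor_push_closed[OF that(1)]) auto
  show ?thesis
  proof (rule moduleI[OF assms(2) ab], unfold B, goal_cases)
    case (1 a x)
    then show ?case using pc by (auto simp: tm simp del: tensor_free_simps)
  next
    case (2 a b x)
    then obtain c where c: "c \<in> carrier ?F" "x = ?K #>\<^bsub>?F\<^esub> c" by blast
    have "tensor_push (\<lambda>x. x) (\<lambda>t. (a \<oplus>\<^bsub>S\<^esub> b) \<otimes>\<^bsub>S\<^esub> t) c - (tensor_push (\<lambda>x. x) (\<lambda>t. a \<otimes>\<^bsub>S\<^esub> t) c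
      + tensor_push (\<lambda>x. x) (\<lambda>t. b \<otimes>\<^bsub>S\<^esub> t) c) \<in> ?K" (is "?P c")
    proof (rule frag_diff_induct[of c "carrier M \<times> carrier S'" ?P], goal_cases)
      case (3 z)
      then show ?case using tensor_rel_gens(2)[of "fst z" M "a \<otimes>\<^bsub>S\<^esub> snd z" S' "b \<otimes>\<^bsub>S\<^esub> snd z"] 2
        by (auto simp: S.l_distr algebra_simps)
    next
      case (4 u v) then show ?case using K(4)[OF 4] by (simp add: algebra_simps)
    qed (use c K(1) in auto)
    then show ?case using 2 c add[OF pc[OF c(1)] pc[OF c(1)]] tensor_coset_eq[OF assms(4) S']
      by (simp add: tm del: tensor_free_simps)
  next
    case (3 a x y)
    then obtain c d where c: "c \<in> carrier ?F" "x = ?K #>\<^bsub>?F\<^esub> c" "d \<in> carrier ?F" "y = ?K #>\<^bsub>?F\<^esub> d" by blast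
    then show ?case using 3 by (simp add: tm add pc del: tensor_free_simps)
  next
    case (4 a b x)
    then obtain c where c: "c \<in> carrier ?F" "x = ?K #>\<^bsub>?F\<^esub> c" by blast
    have "tensor_push (\<lambda>x. x) (\<lambda>t. (a \<otimes>\<^bsub>S\<^esub> b) \<otimes>\<^bsub>S\<^esub> t) c = tensor_push (\<lambda>x. x) (\<lambda>t. a \<otimes>\<^bsub>S\<^esub> t)
      (tensor_push (\<lambda>x. x) (\<lambda>t. b \<otimes>\<^bsub>S\<^esub> t) c)" (is "?P c")
      by (rule frag_diff_induct[of c "carrier M \<times> carrier S'" ?P]) (use c 4 in \<open>auto simp: S.m_assoc\<close>)
    then show ?case using 4 c by (simp add: tm del: tensor_free_simps)
  next
    case (5 x)
    then obtain c where c: "c \<in> carrier ?F" "x = ?K #>\<^bsub>?F\<^esub> c" by blast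
    have "tensor_push (\<lambda>x. x) (\<lambda>t. \<one>\<^bsub>S\<^esub> \<otimes>\<^bsub>S\<^esub> t) c = c" (is "?P c")
      by (rule frag_diff_induct[of c "carrier M \<times> carrier S'" ?P]) (use c in auto)
    then show ?case using c by (simp add: tm del: tensor_free_simps)
  qed
qed

end

theory Submission
  imports "HOL-Algebra.Ring_Divisibility" Defs
begin

text \<open>
  Let \<open>A\<close> be a finite generating set of \<open>M\<close>, \<open>F = R\<^sup>A\<close> and \<open>K\<close> the kernel of \<open>F \<rightarrow> M\<close>. By flatness
  \<open>K\<close> is pure: finitely many relations are fixed by some endomorphism of \<open>F\<close> with image in \<open>K\<close>.
  Right exactness of the tensor product and projectivity of \<open>M \<otimes> S\<close> give such an endomorphism \<open>B\<close>
  that fixes \<open>K\<close> modulo the kernel of \<open>\<phi>\<close>, hence modulo every prime in \<open>X\<close>.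

  If \<open>B\<close> fixes \<open>K\<close> modulo a prime \<open>m\<close>, then \<open>K = B F\<close> after localizing at \<open>m\<close>, by a
  Cayley-Hamilton argument. Thus any \<open>B'\<close> that fixes the image of \<open>B\<close> is the identity on \<open>K\<^sub>m\<close>, and
  in particular fixes \<open>K\<close> modulo every prime \<open>q \<subseteq> m\<close>. This carries the property from \<open>X\<close> to
  \<open>X\<^bsup>(1)\<^esup>\<close> and, after \<open>n\<close> steps, to every maximal ideal; one more step yields a projection of \<open>F\<close>
  onto \<open>K\<close>.
\<close>

section \<open>Function modules and linear combinations\<close>

text \<open>The substitute: the image of an endomorphism \<open>B\<close> of \<open>F\<close> is
  spanned by the finitely many relations \<open>B e_x\<close>, so purity always supplies a
  \<open>B'\<close> that is the identity on it. That \<open>B\<close> fixes \<open>K\<close> modulo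
  an ideal is tested on coordinates in \<open>F\<close>, so it passes to larger ideals at once; the
  specialization half of a cone costs nothing. Generalization is where Cayley-Hamilton enters: the
  local equality of \<open>K\<close> and \<open>B F\<close> is witnessed by an element
  \<open>r\<close> outside \<open>m\<close> with \<open>r (B' w - w) = 0\<close>, and
  \<open>r\<close> is then outside every prime \<open>q\<close> below \<open>m\<close>. No
  localization is ever formed. The price is that \<open>B\<close> is replaced by \<open>B'\<close>
  at each step, hence the induction on \<open>n\<close>. Over \<open>S\<close> finiteness is
  recovered: a section of the map from \<open>S^A\<close> to the base change makes its kernel a
  direct summand of \<open>S^A\<close>, so finitely many relations of \<open>M\<close> control it,
  and a single \<open>B\<close> fixes them all.\<close>

definition vec_module :: "'i set \<Rightarrow> ('r, 'n, 'c) module_scheme \<Rightarrow> ('r, 'i \<Rightarrow> 'n) module" where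
  "vec_module A N = \<lparr>carrier = A \<rightarrow>\<^sub>E carrier N, monoid.mult = undefined, one = undefined,
     ring.zero = (\<lambda>i\<in>A. \<zero>\<^bsub>N\<^esub>), ring.add = (\<lambda>f g. \<lambda>i\<in>A. f i \<oplus>\<^bsub>N\<^esub> g i),
     smult = (\<lambda>r f. \<lambda>i\<in>A. r \<odot>\<^bsub>N\<^esub> f i)\<rparr>"

lemma vec_module_simps [simp]:
  "carrier (vec_module A N) = A \<rightarrow>\<^sub>E carrier N"
  "\<zero>\<^bsub>vec_module A N\<^esub> = (\<lambda>i\<in>A. \<zero>\<^bsub>N\<^esub>)"
  "f \<oplus>\<^bsub>vec_module A N\<^esub> g = (\<lambda>i\<in>A. f i \<oplus>\<^bsub>N\<^esub> g i)"
  "r \<odot>\<^bsub>vec_module A N\<^esub> f = (\<lambda>i\<in>A. r \<odot>\<^bsub>N\<^esub> f i)"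
  by (simp_all add: vec_module_def)

lemma vec_module_module:
  assumes "module R N"
  shows "module R (vec_module A N)"
proof -
  interpret N: module R N by fact
  have "abelian_group (vec_module A N)"
  proof (rule abelian_groupI)
    fix f assume f: "f \<in> carrier (vec_module A N)"
    then show "\<exists>g\<in>carrier (vec_module A N). g \<oplus>\<^bsub>vec_module A N\<^esub> f = \<zero>\<^bsub>vec_module A N\<^esub>"
      by (intro bexI[of _ "\<lambda>i\<in>A. \<ominus>\<^bsub>N\<^esub> f i"]) (auto simp: PiE_iff N.l_neg)
    from f show "\<zero>\<^bsub>vec_module A N\<^esub> \<oplus>\<^bsub>vec_module A N\<^esub> f = f"
      by (auto simp: PiE_iff extensional_def fun_eq_iff)
  qed (auto simp: PiE_iff fun_eq_iff N.a_ac)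
  then show ?thesis
  proof (rule moduleI[OF N.R.is_cring], goal_cases)
    case 5 then show ?case by (auto simp: PiE_iff extensional_def fun_eq_iff)
  qed (auto simp: PiE_iff fun_eq_iff N.smult_l_distr N.smult_r_distr N.smult_assoc1)
qed

lemma finsum_vec_module:
  assumes "module R N" "finite I" "g \<in> I \<rightarrow> (A \<rightarrow>\<^sub>E carrier N)"
  shows "(\<Oplus>\<^bsub>vec_module A N\<^esub>j\<in>I. g j) = (\<lambda>i\<in>A. \<Oplus>\<^bsub>N\<^esub>j\<in>I. g j i)"
proof -
  interpret N: module R N by fact
  interpret V: module R "vec_module A N" by (rule vec_module_module) fact
  show ?thesis using assms(2,3)
  proof (induction I rule: finite_induct)
    case (insert j I)
    then have "(\<lambda>j. g j i) \<in> I \<rightarrow> carrier N" "g j i \<in> carrier N" if "i \<in> A" for i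
      using that by (auto simp: PiE_iff Pi_iff)
    with insert show ?case
      by (auto simp: fun_eq_iff)
  qed auto
qed

text \<open>The ring acts on itself through \<open>restrict_scalars\<close> along the identity, so
  that R^A, S^A and N^A (which stands for F tensor N) are instances of one construction.\<close>

abbreviation free_module :: "('r, 'a) ring_scheme \<Rightarrow> 'i set \<Rightarrow> ('r, 'i \<Rightarrow> 'r) module" where
  "free_module R A \<equiv> vec_module A (restrict_scalars R (\<lambda>x. x))"

lemma restrict_scalars_simps [simp]:
  "carrier (restrict_scalars S \<phi>) = carrier S"
  "\<zero>\<^bsub>restrict_scalars S \<phi>\<^esub> = \<zero>\<^bsub>S\<^esub>"
  "x \<oplus>\<^bsub>restrict_scalars S \<phi>\<^esub> y = x \<oplus>\<^bsub>S\<^esub> y"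
  "r \<odot>\<^bsub>restrict_scalars S \<phi>\<^esub> x = \<phi> r \<otimes>\<^bsub>S\<^esub> x"
  "finsum (restrict_scalars S \<phi>) = finsum S"
  by (simp_all add: restrict_scalars_def finsum_def finprod_def fun_eq_iff)

lemma a_inv_restrict_scalars [simp]: "\<ominus>\<^bsub>restrict_scalars S \<phi>\<^esub> x = \<ominus>\<^bsub>S\<^esub> x"
  by (simp add: restrict_scalars_def a_inv_def m_inv_def)

lemma ring_module_module: "cring R \<Longrightarrow> module R (restrict_scalars R (\<lambda>x. x))"
  by (rule restrict_scalars_module) (auto simp: ring_hom_def)

lemma free_module_module: "cring R \<Longrightarrow> module R (free_module R A)"
  by (intro vec_module_module ring_module_module)

definition unit_vec :: "('r, 'a) ring_scheme \<Rightarrow> 'i set \<Rightarrow> 'i \<Rightarrow> 'i \<Rightarrow> 'r" where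
  "unit_vec R A i = (\<lambda>j\<in>A. if j = i then \<one>\<^bsub>R\<^esub> else \<zero>\<^bsub>R\<^esub>)"

definition lincomb ::
    "('r, 'n, 'c) module_scheme \<Rightarrow> 'i set \<Rightarrow> ('i \<Rightarrow> 'n) \<Rightarrow> ('i \<Rightarrow> 'r) \<Rightarrow> 'n" where
  "lincomb N A u z = (\<Oplus>\<^bsub>N\<^esub>i\<in>A. z i \<odot>\<^bsub>N\<^esub> u i)"

lemma unit_vec_closed [simp]: "cring R \<Longrightarrow> unit_vec R A i \<in> A \<rightarrow>\<^sub>E carrier R"
  by (auto simp: unit_vec_def cring.cring_simprules)

section \<open>Linear maps, and linear maps out of free modules\<close>

lemma mod_homD:
  assumes "f \<in> mod_hom R M N"
  shows "x \<in> carrier M \<Longrightarrow> f x \<in> carrier N"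
    "x \<in> carrier M \<Longrightarrow> y \<in> carrier M \<Longrightarrow> f (x \<oplus>\<^bsub>M\<^esub> y) = f x \<oplus>\<^bsub>N\<^esub> f y"
    "r \<in> carrier R \<Longrightarrow> x \<in> carrier M \<Longrightarrow> f (r \<odot>\<^bsub>M\<^esub> x) = r \<odot>\<^bsub>N\<^esub> f x"
  using assms by (auto simp: mod_hom_def)

lemma mod_homI:
  assumes "\<And>x. x \<in> carrier M \<Longrightarrow> f x \<in> carrier N"
    "\<And>x y. x \<in> carrier M \<Longrightarrow> y \<in> carrier M \<Longrightarrow> f (x \<oplus>\<^bsub>M\<^esub> y) = f x \<oplus>\<^bsub>N\<^esub> f y"
    "\<And>r x. r \<in> carrier R \<Longrightarrow> x \<in> carrier M \<Longrightarrow> f (r \<odot>\<^bsub>M\<^esub> x) = r \<odot>\<^bsub>N\<^esub> f x"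
  shows "f \<in> mod_hom R M N"
  using assms by (auto simp: mod_hom_def)

lemma mod_hom_comp:
  "f \<in> mod_hom R M N \<Longrightarrow> g \<in> mod_hom R N P \<Longrightarrow> (\<lambda>x. g (f x)) \<in> mod_hom R M P"
  by (auto simp: mod_hom_def Pi_iff)

locale module_pair = M: module R M + N: module R N for R (structure) and M and N
begin

lemma mod_hom_zero: "f \<in> mod_hom R M N \<Longrightarrow> f \<zero>\<^bsub>M\<^esub> = \<zero>\<^bsub>N\<^esub>"
  using mod_homD(3)[of f R M N "\<zero>" "\<zero>\<^bsub>M\<^esub>"] mod_homD(1)[of f R M N "\<zero>\<^bsub>M\<^esub>"] by simp

lemma mod_hom_minus:
  assumes "f \<in> mod_hom R M N" "x \<in> carrier M"
  shows "f (\<ominus>\<^bsub>M\<^esub> x) = \<ominus>\<^bsub>N\<^esub> f x"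
  using mod_homD(1)[OF assms] mod_homD(3)[OF assms(1), of "\<ominus> \<one>" x] assms(2)
    M.smult_l_minus[of \<one> x] N.smult_l_minus[of \<one> "f x"] by simp

lemma mod_hom_diff:
  assumes "f \<in> mod_hom R M N" "x \<in> carrier M" "y \<in> carrier M"
  shows "f (x \<ominus>\<^bsub>M\<^esub> y) = f x \<ominus>\<^bsub>N\<^esub> f y"
  using assms by (simp add: a_minus_def mod_homD(2)[OF assms(1)] mod_hom_minus)

lemma mod_hom_finsum:
  assumes "f \<in> mod_hom R M N" "finite I" "g \<in> I \<rightarrow> carrier M"
  shows "f (\<Oplus>\<^bsub>M\<^esub>i\<in>I. g i) = (\<Oplus>\<^bsub>N\<^esub>i\<in>I. f (g i))"
  using assms(2,3)
proof (induction I rule: finite_induct)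
  case (insert i I)
  then have "g i \<in> carrier M" "g \<in> I \<rightarrow> carrier M" by auto
  moreover from this have "(\<lambda>i. f (g i)) \<in> I \<rightarrow> carrier N" "f (g i) \<in> carrier N"
    using mod_homD(1)[OF assms(1)] by auto
  ultimately show ?case using insert by (simp add: mod_homD(2)[OF assms(1)])
qed (simp add: mod_hom_zero[OF assms(1)])

lemma mod_hom_add:
  assumes "f \<in> mod_hom R M N" "g \<in> mod_hom R M N"
  shows "(\<lambda>x. f x \<oplus>\<^bsub>N\<^esub> g x) \<in> mod_hom R M N"
  using assms by (intro mod_homI) (auto simp: mod_homD N.smult_r_distr N.a_ac mod_homD(1)[OF assms(1)] mod_homD(1)[OF assms(2)])

lemma mod_hom_uminus:
  assumes "f \<in> mod_hom R M N"
  shows "(\<lambda>x. \<ominus>\<^bsub>N\<^esub> f x) \<in> mod_hom R M N"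
  using mod_homD[OF assms] by (intro mod_homI) (auto simp: N.smult_r_minus N.minus_add)

lemma mod_hom_minus_fun:
  assumes "f \<in> mod_hom R M N" "g \<in> mod_hom R M N"
  shows "(\<lambda>x. f x \<ominus>\<^bsub>N\<^esub> g x) \<in> mod_hom R M N"
  unfolding a_minus_def by (intro mod_hom_add mod_hom_uminus assms)

end

context module
begin

lemma lincomb_closed [simp]:
  "z \<in> A \<rightarrow> carrier R \<Longrightarrow> u \<in> A \<rightarrow> carrier M \<Longrightarrow> lincomb M A u z \<in> carrier M"
  unfolding lincomb_def by (intro M.finsum_closed) auto

lemma lincomb_hom:
  assumes "finite A" "u \<in> A \<rightarrow> carrier M"
  shows "lincomb M A u \<in> mod_hom R (free_module R A) M"
proof (rule mod_homI)
  fix z w assume zw: "z \<in> carrier (free_module R A)" "w \<in> carrier (free_module R A)"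
  then have "(\<Oplus>\<^bsub>M\<^esub>i\<in>A. (z \<oplus>\<^bsub>free_module R A\<^esub> w) i \<odot>\<^bsub>M\<^esub> u i) =
    (\<Oplus>\<^bsub>M\<^esub>i\<in>A. z i \<odot>\<^bsub>M\<^esub> u i \<oplus>\<^bsub>M\<^esub> w i \<odot>\<^bsub>M\<^esub> u i)"
    using assms by (intro M.finsum_cong') (auto simp: PiE_iff Pi_iff intro!: smult_l_distr)
  then show "lincomb M A u (z \<oplus>\<^bsub>free_module R A\<^esub> w) = lincomb M A u z \<oplus>\<^bsub>M\<^esub> lincomb M A u w"
    unfolding lincomb_def using assms zw by (subst M.finsum_addf[symmetric]) auto
next
  fix r z assume z: "r \<in> carrier R" "z \<in> carrier (free_module R A)"
  have "(\<Oplus>\<^bsub>M\<^esub>i\<in>A. (r \<odot>\<^bsub>free_module R A\<^esub> z) i \<odot>\<^bsub>M\<^esub> u i) = (\<Oplus>\<^bsub>M\<^esub>i\<in>A. r \<odot>\<^bsub>M\<^esub> (z i \<odot>\<^bsub>M\<^esub> u i))"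
    using assms z by (intro M.finsum_cong') (auto simp: PiE_iff Pi_iff smult_assoc1)
  then show "lincomb M A u (r \<odot>\<^bsub>free_module R A\<^esub> z) = r \<odot>\<^bsub>M\<^esub> lincomb M A u z"
    unfolding lincomb_def using assms z by (subst finsum_smult_ldistr) auto
qed (use assms in \<open>auto intro!: lincomb_closed\<close>)

lemma lincomb_unit_vec:
  assumes "finite A" "u \<in> A \<rightarrow> carrier M" "x \<in> A"
  shows "lincomb M A u (unit_vec R A x) = u x"
proof -
  have "lincomb M A u (unit_vec R A x) = (\<Oplus>\<^bsub>M\<^esub>i\<in>A. if x = i then u i else \<zero>\<^bsub>M\<^esub>)"
    unfolding lincomb_def using assms by (intro M.finsum_cong') (auto simp: unit_vec_def Pi_iff)
  also have "\<dots> = u x" using assms by (intro M.add.finprod_singleton) auto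
  finally show ?thesis .
qed

end

lemma (in cring) lincomb_unit_vecs:
  assumes "finite A" "z \<in> A \<rightarrow>\<^sub>E carrier R"
  shows "lincomb (free_module R A) A (unit_vec R A) z = z"
proof -
  interpret S: module R "restrict_scalars R (\<lambda>x. x)" by (rule ring_module_module) unfold_locales
  have cr: "cring R" by unfold_locales
  have "lincomb (free_module R A) A (unit_vec R A) z =
      (\<lambda>i\<in>A. \<Oplus>j\<in>A. (z j \<odot>\<^bsub>free_module R A\<^esub> unit_vec R A j) i)"
    unfolding lincomb_def using assms cr
    by (subst finsum_vec_module[OF S.module_axioms]) (auto simp: unit_vec_def PiE_iff Pi_iff)
  also have "\<dots> = z"
  proof
    fix i
    show "(\<lambda>i\<in>A. \<Oplus>j\<in>A. (z j \<odot>\<^bsub>free_module R A\<^esub> unit_vec R A j) i) i = z i"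
    proof (cases "i \<in> A")
      case True
      have "(\<Oplus>j\<in>A. (z j \<odot>\<^bsub>free_module R A\<^esub> unit_vec R A j) i) = (\<Oplus>j\<in>A. if i = j then z j else \<zero>)"
        using assms True by (intro finsum_cong') (auto simp: unit_vec_def PiE_iff Pi_iff)
      also have "\<dots> = z i" using assms True by (intro add.finprod_singleton) auto
      finally show ?thesis using True by simp
    qed (use assms in \<open>auto simp: PiE_iff extensional_def\<close>)
  qed
  finally show ?thesis .
qed

lemma (in module) mod_hom_free_module_eq:
  assumes "finite A" "f \<in> mod_hom R (free_module R A) M" "z \<in> A \<rightarrow>\<^sub>E carrier R"
  shows "f z = lincomb M A (\<lambda>i. f (unit_vec R A i)) z"
proof -
  interpret F: module_pair R "free_module R A" M
    unfolding module_pair_def using free_module_module[OF R.is_cring] module_axioms by blast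
  have "f z = f (lincomb (free_module R A) A (unit_vec R A) z)"
    using assms by (simp add: R.lincomb_unit_vecs)
  also have "\<dots> = (\<Oplus>\<^bsub>M\<^esub>i\<in>A. f (z i \<odot>\<^bsub>free_module R A\<^esub> unit_vec R A i))"
    unfolding lincomb_def using assms(1,3) by (intro F.mod_hom_finsum[OF assms(2)]) (auto simp: unit_vec_def PiE_iff Pi_iff)
  also have "\<dots> = lincomb M A (\<lambda>i. f (unit_vec R A i)) z"
    unfolding lincomb_def
  proof (intro M.finsum_cong' refl)
    have e: "unit_vec R A i \<in> carrier (free_module R A)" for i
      using unit_vec_closed[OF R.is_cring] by simp
    show "(\<lambda>i. z i \<odot>\<^bsub>M\<^esub> f (unit_vec R A i)) \<in> A \<rightarrow> carrier M"
      using assms(3) mod_homD(1)[OF assms(2) e] by auto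
    show "f (z i \<odot>\<^bsub>free_module R A\<^esub> unit_vec R A i) = z i \<odot>\<^bsub>M\<^esub> f (unit_vec R A i)"
      if "i \<in> A" for i using assms(3) that by (intro mod_homD(3)[OF assms(2) _ e]) auto
  qed
  finally show ?thesis .
qed

section \<open>Polynomials in an operator\<close>

lemma (in ring) ideal_add_cancel:
  assumes "ideal I R" "x \<oplus> y \<in> I" "y \<in> I" "x \<in> carrier R"
  shows "x \<in> I"
proof -
  interpret I: ideal I R by fact
  have "(x \<oplus> y) \<oplus> \<ominus> y \<in> I" by (intro I.a_closed[OF assms(2)] I.a_inv_closed assms(3))
  moreover have "(x \<oplus> y) \<oplus> \<ominus> y = x"
    using I.Icarr[OF assms(3)] assms(4) by (simp add: a_assoc r_neg)
  ultimately show ?thesis by simp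
qed

context module
begin

text \<open>\<open>operator_poly N f a\<close> encodes \<open>f = P(N)\<close> and \<open>a = P(1)\<close> for a polynomial \<open>P\<close> over \<open>R\<close>. Only the value
  at \<open>1\<close> matters, as \<open>N\<close> will fix the vector of interest.\<close>

inductive operator_poly :: "('c \<Rightarrow> 'c) \<Rightarrow> ('c \<Rightarrow> 'c) \<Rightarrow> 'a \<Rightarrow> bool" for N where
  scalar: "r \<in> carrier R \<Longrightarrow> operator_poly N (\<lambda>x. r \<odot>\<^bsub>M\<^esub> x) r"
| base: "operator_poly N N \<one>"
| add: "operator_poly N f a \<Longrightarrow> operator_poly N g b \<Longrightarrow> operator_poly N (\<lambda>x. f x \<oplus>\<^bsub>M\<^esub> g x) (a \<oplus> b)"
| comp: "operator_poly N f a \<Longrightarrow> operator_poly N g b \<Longrightarrow> operator_poly N (\<lambda>x. f (g x)) (a \<otimes> b)"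

lemma smult_mod_hom: "r \<in> carrier R \<Longrightarrow> (\<lambda>x. r \<odot>\<^bsub>M\<^esub> x) \<in> mod_hom R M M"
  by (intro mod_homI) (auto simp: smult_r_distr smult_assoc1[symmetric] R.m_comm)

context
  fixes N assumes N: "N \<in> mod_hom R M M"
begin

interpretation MM: module_pair R M M
  unfolding module_pair_def using module_axioms by blast

lemma operator_poly_hom:
  "operator_poly N f a \<Longrightarrow> f \<in> mod_hom R M M"
  "operator_poly N f a \<Longrightarrow> a \<in> carrier R"
proof (induction rule: operator_poly.inducts)
  case (add f a g b) case 1 then show ?case using add MM.mod_hom_add by blast
next
  case (comp f a g b) case 1 then show ?case using comp mod_hom_comp by blast
qed (auto simp: N smult_mod_hom)

lemma operator_poly_commute:
  assumes f: "operator_poly N f a" and g: "operator_poly N g b" and x: "x \<in> carrier M"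
  shows "f (g x) = g (f x)"
proof -
  \<comment> \<open>Commutation with \<open>N\<close> itself comes first: it is the base case of the
    second induction, in which \<open>f\<close> is fixed and \<open>g\<close> is built up.\<close>
  have cN: "g (N x) = N (g x)" if "operator_poly N g b" "x \<in> carrier M" for g b x
    using that
  proof (induction arbitrary: x rule: operator_poly.induct)
    case (scalar r) then show ?case by (simp add: mod_homD(3)[OF N])
  next
    case (add f a g b)
    then show ?case
      using mod_homD(1)[OF operator_poly_hom(1)] by (simp add: mod_homD(2)[OF N])
  next
    case (comp f a g b)
    then show ?case using mod_homD(1)[OF operator_poly_hom(1)] by simp
  qed simp
  note fh = mod_homD[OF operator_poly_hom(1)[OF f]]
  show ?thesis using g x
  proof (induction arbitrary: x rule: operator_poly.induct)
    case (add g a h b)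
    then show ?case using mod_homD(1)[OF operator_poly_hom(1)] by (simp add: fh(2))
  next
    case (comp g a h b)
    then show ?case using mod_homD(1)[OF operator_poly_hom(1)] by simp
  qed (auto simp: fh(3) cN[OF f])
qed

text \<open>Modulo the invariant submodule \<open>L\<close> the vector \<open>w\<close> is fixed by
  \<open>N\<close>, so P(N) acts on it as multiplication by P(1).\<close>

lemma operator_poly_value:
  assumes f: "operator_poly N f a" and L: "submodule L R M" and NL: "N ` L \<subseteq> L"
    and w: "w \<in> carrier M" "N w \<ominus>\<^bsub>M\<^esub> w \<in> L"
  shows "f w \<ominus>\<^bsub>M\<^esub> a \<odot>\<^bsub>M\<^esub> w \<in> L"
proof -
  note LE = submoduleE[OF L]
  have Lc: "x \<in> carrier M" if "x \<in> L" for x using LE(1) that by blast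
  have Ld: "x \<ominus>\<^bsub>M\<^esub> y \<in> L" if "x \<in> L" "y \<in> L" for x y
    using LE(3,5) that unfolding a_minus_def by blast
  have z: "\<zero>\<^bsub>M\<^esub> \<in> L" using LE(2) Ld Lc by (metis M.r_neg a_minus_def ex_in_conv)
  have fL: "f x \<in> L" if "operator_poly N f a" "x \<in> L" for f a x
    using that by (induction arbitrary: x rule: operator_poly.induct) (use NL LE in auto)
  show ?thesis using f
  proof (induction rule: operator_poly.induct)
    case (scalar r)
    then show ?case using w z by (simp add: a_minus_def M.r_neg)
  next
    case base
    then show ?case using w by simp
  next
    case (add f a g b)
    note c = operator_poly_hom[OF add(1)] operator_poly_hom[OF add(2)]
    have "(f w \<oplus>\<^bsub>M\<^esub> g w) \<ominus>\<^bsub>M\<^esub> (a \<oplus> b) \<odot>\<^bsub>M\<^esub> w =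
        (f w \<ominus>\<^bsub>M\<^esub> a \<odot>\<^bsub>M\<^esub> w) \<oplus>\<^bsub>M\<^esub> (g w \<ominus>\<^bsub>M\<^esub> b \<odot>\<^bsub>M\<^esub> w)"
      using c w mod_homD(1)[OF c(1)] mod_homD(1)[OF c(3)]
      by (simp add: smult_l_distr a_minus_def M.minus_add M.a_ac)
    then show ?case using add LE(5) by simp
  next
    case (comp f a g b)
    note c = operator_poly_hom[OF comp(1)] operator_poly_hom[OF comp(2)]
    have fg: "f w \<in> carrier M" "g w \<in> carrier M" "f (g w) \<in> carrier M"
      using w mod_homD(1)[OF c(1)] mod_homD(1)[OF c(3)] by auto
    have "f (g w) \<ominus>\<^bsub>M\<^esub> (a \<otimes> b) \<odot>\<^bsub>M\<^esub> w =
        f (g w \<ominus>\<^bsub>M\<^esub> b \<odot>\<^bsub>M\<^esub> w) \<oplus>\<^bsub>M\<^esub> b \<odot>\<^bsub>M\<^esub> (f w \<ominus>\<^bsub>M\<^esub> a \<odot>\<^bsub>M\<^esub> w)"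
    proof -
      have "f (g w \<ominus>\<^bsub>M\<^esub> b \<odot>\<^bsub>M\<^esub> w) = f (g w) \<ominus>\<^bsub>M\<^esub> b \<odot>\<^bsub>M\<^esub> f w"
        using fg c w by (simp add: MM.mod_hom_diff[OF c(1)] mod_homD(3)[OF c(1)])
      moreover have "b \<odot>\<^bsub>M\<^esub> (f w \<ominus>\<^bsub>M\<^esub> a \<odot>\<^bsub>M\<^esub> w) = b \<odot>\<^bsub>M\<^esub> f w \<ominus>\<^bsub>M\<^esub> (a \<otimes> b) \<odot>\<^bsub>M\<^esub> w"
        using fg c w by (simp add: a_minus_def smult_r_distr smult_r_minus smult_assoc1[symmetric] R.m_comm)
      moreover have "f (g w) \<ominus>\<^bsub>M\<^esub> (a \<otimes> b) \<odot>\<^bsub>M\<^esub> w = (f (g w) \<ominus>\<^bsub>M\<^esub> b \<odot>\<^bsub>M\<^esub> f w) \<oplus>\<^bsub>M\<^esub> (b \<odot>\<^bsub>M\<^esub> f w \<ominus>\<^bsub>M\<^esub> (a \<otimes> b) \<odot>\<^bsub>M\<^esub> w)"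
        using fg c w by (simp add: a_minus_def M.a_assoc M.l_neg M.r_neg1)
      ultimately show ?thesis by simp
    qed
    then show ?case using comp LE(4,5) fL c by simp
  qed
qed

text \<open>Gaussian elimination over the commutative ring of polynomials in \<open>N\<close>, in
  place of determinants and adjugates. Rows are cross-multiplied instead of divided. Evaluated at 1
  the matrix is diagonal modulo \<open>p\<close> with diagonal entries outside \<open>p\<close>, and
  primality of \<open>p\<close> preserves this shape.\<close>

lemma operator_poly_elimination:
  assumes p: "primeideal p R" and fin: "finite I" and e: "e \<in> I \<rightarrow> carrier M"
    and "\<And>i j. i \<in> I \<Longrightarrow> j \<in> I \<Longrightarrow> operator_poly N (a i j) (v i j)"
    and "\<And>i. i \<in> I \<Longrightarrow> v i i \<notin> p"
    and "\<And>i j. i \<in> I \<Longrightarrow> j \<in> I \<Longrightarrow> i \<noteq> j \<Longrightarrow> v i j \<in> p"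
    and "\<And>i. i \<in> I \<Longrightarrow> (\<Oplus>\<^bsub>M\<^esub>j\<in>I. a i j (e j)) = \<zero>\<^bsub>M\<^esub>"
  shows "\<exists>f r. operator_poly N f r \<and> r \<notin> p \<and> (\<forall>i\<in>I. f (e i) = \<zero>\<^bsub>M\<^esub>)"
  using fin e assms(4-)
proof (induction I arbitrary: a v rule: finite_induct)
  case empty
  have "\<one> \<notin> p" using primeideal.I_notcarr[OF p] ideal.one_imp_carrier[OF primeideal.axioms(1)[OF p]] by blast
  then show ?case using operator_poly.base by blast
next
  case (insert k I)
  interpret p: primeideal p R by (rule p)
  have ec: "e k \<in> carrier M" "\<And>j. j \<in> I \<Longrightarrow> e j \<in> carrier M" using insert.prems(1) by auto
  note pol = insert.prems(2)
  note hom = operator_poly_hom(1)[OF pol]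
  note cl = mod_homD(1)[OF hom]
  have vc: "v i j \<in> carrier R" if "i \<in> insert k I" "j \<in> insert k I" for i j
    using operator_poly_hom(2)[OF pol[OF that]] .
  have kk: "k \<in> insert k I" by simp
  \<comment> \<open>Pivot \<open>a k k\<close> times row \<open>i\<close> minus \<open>a i k\<close>
    times row \<open>k\<close>: the coefficient of \<open>e k\<close> cancels because the operators
    commute. The sign is written as the scalar \<open>\<ominus> \<one>\<close> to stay within
    \<open>operator_poly\<close>.\<close>
  let ?a = "\<lambda>i j x. a k k (a i j x) \<oplus>\<^bsub>M\<^esub> (\<ominus> \<one>) \<odot>\<^bsub>M\<^esub> a i k (a k j x)"
  let ?v = "\<lambda>i j. v k k \<otimes> v i j \<oplus> (\<ominus> \<one>) \<otimes> (v i k \<otimes> v k j)"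
  have "\<exists>f r. operator_poly N f r \<and> r \<notin> p \<and> (\<forall>i\<in>I. f (e i) = \<zero>\<^bsub>M\<^esub>)"
  proof (rule insert.IH[of ?a ?v])
    show "e \<in> I \<rightarrow> carrier M" using ec by auto
  next
    fix i j assume ij: "i \<in> I" "j \<in> I"
    then show "operator_poly N (?a i j) (?v i j)"
      using pol by (intro operator_poly.add operator_poly.comp[of _ "\<lambda>x. (\<ominus> \<one>) \<odot>\<^bsub>M\<^esub> x"] operator_poly.comp operator_poly.scalar) auto
    have low: "(\<ominus> \<one>) \<otimes> (v i k \<otimes> v k j) \<in> p" if "i \<in> I" "j \<in> I" for i j
      using that insert.prems(4)[of i k] insert.hyps(2) vc
      by (intro p.I_l_closed p.I_r_closed) auto
    show "?v i j \<in> p" if "i \<noteq> j"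
      using ij that insert.prems(4)[of i j] vc[OF kk kk] low[OF ij]
      by (auto intro: p.a_closed p.I_l_closed simp del: R.l_minus)
    show "?v i i \<notin> p"
    proof
      assume "?v i i \<in> p"
      then have "v k k \<otimes> v i i \<in> p"
        using R.ideal_add_cancel[OF p.is_ideal] low[OF ij(1) ij(1)] vc[OF kk kk] vc[of i i] ij(1) by (meson R.m_closed insertI2)
      then show False using p.I_prime[of "v k k" "v i i"] vc ij insert.prems(3) by auto
    qed
  next
    fix i assume i: "i \<in> I"
    have ak: "(\<Oplus>\<^bsub>M\<^esub>j\<in>I. a l j (e j)) = \<ominus>\<^bsub>M\<^esub> a l k (e k)" if l: "l \<in> insert k I" for l
    proof -
      have c: "(\<lambda>j. a l j (e j)) \<in> I \<rightarrow> carrier M" "a l k (e k) \<in> carrier M" using cl l ec by auto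
      then have "a l k (e k) \<oplus>\<^bsub>M\<^esub> (\<Oplus>\<^bsub>M\<^esub>j\<in>I. a l j (e j)) = \<zero>\<^bsub>M\<^esub>"
        using insert.prems(5)[OF l] insert.hyps by simp
      then show ?thesis using c by (metis M.a_comm M.finsum_closed M.minus_equality)
    qed
    have c: "(\<lambda>j. a i j (e j)) \<in> I \<rightarrow> carrier M" "(\<lambda>j. a k j (e j)) \<in> I \<rightarrow> carrier M"
      using cl i ec by auto
    have c2: "(\<lambda>j. a k k (a i j (e j))) \<in> I \<rightarrow> carrier M" "(\<lambda>j. a i k (a k j (e j))) \<in> I \<rightarrow> carrier M"
      using c cl i by (auto simp: Pi_iff)
    have "(\<Oplus>\<^bsub>M\<^esub>j\<in>I. ?a i j (e j)) =
      (\<Oplus>\<^bsub>M\<^esub>j\<in>I. a k k (a i j (e j))) \<oplus>\<^bsub>M\<^esub> (\<ominus> \<one>) \<odot>\<^bsub>M\<^esub> (\<Oplus>\<^bsub>M\<^esub>j\<in>I. a i k (a k j (e j)))"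
      using c2 insert.hyps(1) by (subst M.finsum_addf) (auto simp: finsum_smult_ldistr)
    also have "\<dots> = a k k (\<ominus>\<^bsub>M\<^esub> a i k (e k)) \<oplus>\<^bsub>M\<^esub> (\<ominus> \<one>) \<odot>\<^bsub>M\<^esub> a i k (\<ominus>\<^bsub>M\<^esub> a k k (e k))"
      using MM.mod_hom_finsum[OF hom insert.hyps(1) c(1), of k k] i
        MM.mod_hom_finsum[OF hom insert.hyps(1) c(2), of i k] by (simp add: ak)
    also have "\<dots> = \<ominus>\<^bsub>M\<^esub> a k k (a i k (e k)) \<oplus>\<^bsub>M\<^esub> a k k (a i k (e k))"
      using MM.mod_hom_minus[OF hom] cl ec i operator_poly_commute[OF pol pol]
      by (simp add: smult_l_minus)
    also have "\<dots> = \<zero>\<^bsub>M\<^esub>" using cl ec i by (intro M.l_neg) auto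
    finally show "(\<Oplus>\<^bsub>M\<^esub>j\<in>I. ?a i j (e j)) = \<zero>\<^bsub>M\<^esub>" .
  qed
  then obtain f r where f: "operator_poly N f r" "r \<notin> p" "\<And>i. i \<in> I \<Longrightarrow> f (e i) = \<zero>\<^bsub>M\<^esub>" by blast
  note fh = operator_poly_hom(1)[OF f(1)]
  have z: "f (a k k (e i)) = \<zero>\<^bsub>M\<^esub>" if "i \<in> I" for i
    using operator_poly_commute[OF f(1) pol[OF kk kk]] ec that f(3)[OF that] MM.mod_hom_zero[OF hom[OF kk kk]] by simp
  \<comment> \<open>By row \<open>k\<close>, the vector \<open>a k k (e k)\<close> is minus the sum
    of the \<open>a k j (e j)\<close> with \<open>j \<in> I\<close>, and \<open>f\<close> kills each
    of these since it commutes with \<open>a k j\<close>. So \<open>f\<close> after the pivot also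
    annihilates the vector that was eliminated.\<close>
  have "f (a k k (e k)) = \<zero>\<^bsub>M\<^esub>"
  proof -
    have c: "(\<lambda>j. a k j (e j)) \<in> insert k I \<rightarrow> carrier M" using cl ec by auto
    have "\<zero>\<^bsub>M\<^esub> = f (\<Oplus>\<^bsub>M\<^esub>j\<in>insert k I. a k j (e j))"
      using insert.prems(5)[OF kk] MM.mod_hom_zero[OF fh] by simp
    also have "\<dots> = (\<Oplus>\<^bsub>M\<^esub>j\<in>insert k I. f (a k j (e j)))"
      using c insert.hyps by (intro MM.mod_hom_finsum[OF fh]) auto
    also have "\<dots> = f (a k k (e k)) \<oplus>\<^bsub>M\<^esub> (\<Oplus>\<^bsub>M\<^esub>j\<in>I. f (a k j (e j)))"
      using c insert.hyps mod_homD(1)[OF fh] by (intro M.finsum_insert) auto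
    also have "(\<Oplus>\<^bsub>M\<^esub>j\<in>I. f (a k j (e j))) = (\<Oplus>\<^bsub>M\<^esub>j\<in>I. \<zero>\<^bsub>M\<^esub>)"
      using operator_poly_commute[OF f(1) pol] ec f(3) MM.mod_hom_zero[OF hom]
      by (intro M.finsum_cong') auto
    finally show ?thesis using cl[OF kk kk ec(1)] mod_homD(1)[OF fh] by simp
  qed
  moreover have "r \<otimes> v k k \<notin> p"
    using p.I_prime[of r "v k k"] f(2) insert.prems(3)[OF kk] vc[OF kk kk] operator_poly_hom(2)[OF f(1)] by auto
  ultimately show ?case using z operator_poly.comp[OF f(1) pol[OF kk kk]] by blast
qed

text \<open>A Cayley-Hamilton statement: for an operator whose matrix is trivial modulo \<open>p\<close>, the
  annihilating polynomial takes a value outside \<open>p\<close> at \<open>1\<close>.\<close>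

lemma operator_poly_annihilates:
  assumes p: "primeideal p R" and fin: "finite I" and e: "e \<in> I \<rightarrow> carrier M"
    and n: "\<And>i j. i \<in> I \<Longrightarrow> j \<in> I \<Longrightarrow> n i j \<in> p"
    and Ne: "\<And>i. i \<in> I \<Longrightarrow> N (e i) = (\<Oplus>\<^bsub>M\<^esub>j\<in>I. n i j \<odot>\<^bsub>M\<^esub> e j)"
  shows "\<exists>f r. operator_poly N f r \<and> r \<notin> p \<and> (\<forall>i\<in>I. f (e i) = \<zero>\<^bsub>M\<^esub>)"
proof -
  interpret p: primeideal p R by (rule p)
  have nc: "n i j \<in> carrier R" if "i \<in> I" "j \<in> I" for i j using n[OF that] p.a_subset by blast
  \<comment> \<open>The matrix with \<open>N\<close> on the diagonal minus the matrix
    \<open>n\<close>; each of its rows annihilates the family \<open>e\<close>. At 1 its diagonal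
    entries are 1 - \<open>n i i\<close>, outside \<open>p\<close> because
    \<open>n i i \<in> p\<close> and 1 is not in \<open>p\<close>.\<close>
  let ?a = "\<lambda>i j. if i = j then (\<lambda>x. N x \<oplus>\<^bsub>M\<^esub> (\<ominus> n i j) \<odot>\<^bsub>M\<^esub> x) else (\<lambda>x. (\<ominus> n i j) \<odot>\<^bsub>M\<^esub> x)"
  let ?v = "\<lambda>i j. if i = j then \<one> \<oplus> \<ominus> n i j else \<ominus> n i j"
  show ?thesis
  proof (rule operator_poly_elimination[OF p fin e, of ?a ?v])
    show "operator_poly N (?a i j) (?v i j)" if "i \<in> I" "j \<in> I" for i j
      using that nc by (auto intro!: operator_poly.intros)
    show "?v i j \<in> p" if "i \<in> I" "j \<in> I" "i \<noteq> j" for i j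
      using that n by (auto intro: p.a_inv_closed)
  next
    fix i assume i: "i \<in> I"
    have "\<one> \<oplus> \<ominus> n i i \<oplus> n i i = \<one>" using nc i by (simp add: R.a_assoc R.l_neg)
    then show "?v i i \<notin> p"
      using p.a_closed[of "\<one> \<oplus> \<ominus> n i i" "n i i"] n[OF i i] p.I_notcarr p.one_imp_carrier by auto
    have ec: "e j \<in> carrier M" if "j \<in> I" for j using e that by auto
    have c: "(\<lambda>j. n i j \<odot>\<^bsub>M\<^esub> e j) \<in> I \<rightarrow> carrier M" using ec nc i by auto
    have "(\<Oplus>\<^bsub>M\<^esub>j\<in>I. ?a i j (e j)) =
      (\<Oplus>\<^bsub>M\<^esub>j\<in>I. (if i = j then N (e j) else \<zero>\<^bsub>M\<^esub>) \<oplus>\<^bsub>M\<^esub> (\<ominus> \<one>) \<odot>\<^bsub>M\<^esub> (n i j \<odot>\<^bsub>M\<^esub> e j))"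
      using ec nc i mod_homD(1)[OF N] by (intro M.finsum_cong') (auto simp: smult_l_minus)
    also have "\<dots> = (\<Oplus>\<^bsub>M\<^esub>j\<in>I. if i = j then N (e j) else \<zero>\<^bsub>M\<^esub>) \<oplus>\<^bsub>M\<^esub>
        (\<Oplus>\<^bsub>M\<^esub>j\<in>I. (\<ominus> \<one>) \<odot>\<^bsub>M\<^esub> (n i j \<odot>\<^bsub>M\<^esub> e j))"
      using ec nc i mod_homD(1)[OF N] by (intro M.finsum_addf) auto
    also have "(\<Oplus>\<^bsub>M\<^esub>j\<in>I. if i = j then N (e j) else \<zero>\<^bsub>M\<^esub>) = N (e i)"
      using i fin ec mod_homD(1)[OF N] by (intro M.add.finprod_singleton) auto
    also have "(\<Oplus>\<^bsub>M\<^esub>j\<in>I. (\<ominus> \<one>) \<odot>\<^bsub>M\<^esub> (n i j \<odot>\<^bsub>M\<^esub> e j)) = (\<ominus> \<one>) \<odot>\<^bsub>M\<^esub> N (e i)"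
      using fin c by (simp add: Ne[OF i] finsum_smult_ldistr)
    also have "N (e i) \<oplus>\<^bsub>M\<^esub> (\<ominus> \<one>) \<odot>\<^bsub>M\<^esub> N (e i) = \<zero>\<^bsub>M\<^esub>"
      using mod_homD(1)[OF N ec[OF i]] by (simp add: smult_l_minus M.r_neg)
    finally show "(\<Oplus>\<^bsub>M\<^esub>j\<in>I. ?a i j (e j)) = \<zero>\<^bsub>M\<^esub>" .
  qed
qed

end

end

section \<open>Relations of a finitely generated module\<close>

lemma a_inv_vec_module:
  assumes "module R N" "f \<in> A \<rightarrow>\<^sub>E carrier N"
  shows "\<ominus>\<^bsub>vec_module A N\<^esub> f = (\<lambda>i\<in>A. \<ominus>\<^bsub>N\<^esub> f i)"
proof -
  interpret N: module R N by fact
  interpret V: module R "vec_module A N" by (rule vec_module_module) fact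
  show ?thesis
    using assms(2) by (intro V.minus_equality) (auto simp: PiE_iff fun_eq_iff N.l_neg)
qed

lemma a_minus_vec_module:
  assumes "module R N" "f \<in> A \<rightarrow>\<^sub>E carrier N" "g \<in> A \<rightarrow>\<^sub>E carrier N" "i \<in> A"
  shows "(f \<ominus>\<^bsub>vec_module A N\<^esub> g) i = f i \<ominus>\<^bsub>N\<^esub> g i"
  using assms by (simp add: a_minus_def a_inv_vec_module)

lemma (in module) mod_hom_free_module_cong:
  assumes "finite A" "f \<in> mod_hom R (free_module R A) M" "g \<in> mod_hom R (free_module R A) M"
    and "\<And>x. x \<in> A \<Longrightarrow> f (unit_vec R A x) = g (unit_vec R A x)" "z \<in> A \<rightarrow>\<^sub>E carrier R"
  shows "f z = g z"
proof -
  have e: "unit_vec R A x \<in> carrier (free_module R A)" for x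
    using unit_vec_closed[OF R.is_cring] by simp
  have "lincomb M A (\<lambda>i. f (unit_vec R A i)) z = lincomb M A (\<lambda>i. g (unit_vec R A i)) z"
    unfolding lincomb_def using assms(4,5) mod_homD(1)[OF assms(3) e]
    by (intro M.finsum_cong') auto
  then show ?thesis using assms by (simp add: mod_hom_free_module_eq)
qed

lemma (in module_pair) mod_hom_image_submodule:
  assumes f: "f \<in> mod_hom R M N"
  shows "submodule (f ` carrier M) R N"
proof (rule N.submoduleI)
  show "f ` carrier M \<subseteq> carrier N" using mod_homD(1)[OF f] by blast
  show "\<zero>\<^bsub>N\<^esub> \<in> f ` carrier M" using mod_hom_zero[OF f] by (intro image_eqI[of _ _ "\<zero>\<^bsub>M\<^esub>"]) auto
  fix y assume "y \<in> f ` carrier M"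
  then obtain x where x: "x \<in> carrier M" "y = f x" by blast
  show "\<ominus>\<^bsub>N\<^esub> y \<in> f ` carrier M"
    using x mod_hom_minus[OF f x(1)] by (intro image_eqI[of _ _ "\<ominus>\<^bsub>M\<^esub> x"]) auto
  show "r \<odot>\<^bsub>N\<^esub> y \<in> f ` carrier M" if "r \<in> carrier R" for r
    using x that mod_homD(3)[OF f that x(1)] by (intro image_eqI[of _ _ "r \<odot>\<^bsub>M\<^esub> x"]) auto
  fix z assume "z \<in> f ` carrier M"
  then obtain w where w: "w \<in> carrier M" "z = f w" by blast
  show "y \<oplus>\<^bsub>N\<^esub> z \<in> f ` carrier M"
    using x w mod_homD(2)[OF f x(1) w(1)] by (intro image_eqI[of _ _ "x \<oplus>\<^bsub>M\<^esub> w"]) auto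
qed

section \<open>The presentation of \<open>M\<close> by \<open>F\<close> and the maps from
  \<open>F\<close> into the relations\<close>

locale presentation = module R M for R (structure) and M (structure) +
  fixes A
  assumes fin: "finite A" and sub: "A \<subseteq> carrier M"
    and onto: "x \<in> carrier M \<Longrightarrow> \<exists>z\<in>carrier (free_module R A). lincomb M A (\<lambda>x. x) z = x"
begin

abbreviation F where "F \<equiv> free_module R A"

definition relations where
  "relations = {z \<in> carrier F. lincomb M A (\<lambda>x. x) z = \<zero>\<^bsub>M\<^esub>}"

text \<open>These are the linear maps from \<open>F\<close> to \<open>K\<close>, kept as
  endomorphisms of \<open>F\<close> so that they can be composed with each other.\<close>

definition rel_endos where
  "rel_endos = {B \<in> mod_hom R F F. B ` carrier F \<subseteq> relations}"

sublocale F: module R F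
  by (rule free_module_module) unfold_locales

sublocale FM: module_pair R F M
  unfolding module_pair_def using F.module_axioms module_axioms by blast

sublocale FF: module_pair R F F
  unfolding module_pair_def using F.module_axioms by blast

lemma presentation_hom: "lincomb M A (\<lambda>x. x) \<in> mod_hom R F M"
  using fin sub by (intro lincomb_hom) auto

lemma relations_closed: "w \<in> relations \<Longrightarrow> w \<in> carrier F"
  by (simp add: relations_def)

lemma relations_submodule: "submodule relations R F"
proof (rule F.submoduleI)
  show "\<ominus>\<^bsub>F\<^esub> a \<in> relations" if "a \<in> relations" for a
    using that FM.mod_hom_minus[OF presentation_hom] F.a_inv_closed[of a] unfolding relations_def by simp
  show "a \<oplus>\<^bsub>F\<^esub> b \<in> relations" if "a \<in> relations" "b \<in> relations" for a b
    using that mod_homD(2)[OF presentation_hom] F.a_closed[of a b] unfolding relations_def by simp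
  show "a \<odot>\<^bsub>F\<^esub> b \<in> relations" if "a \<in> carrier R" "b \<in> relations" for a b
    using that mod_homD(3)[OF presentation_hom] F.smult_closed[of a b] unfolding relations_def by simp
  show "\<zero>\<^bsub>F\<^esub> \<in> relations"
    using FM.mod_hom_zero[OF presentation_hom] F.zero_closed unfolding relations_def by simp
qed (auto simp: relations_def)

lemmas relations_smult = F.submoduleE(4)[OF relations_submodule]
lemmas relations_add = F.submoduleE(5)[OF relations_submodule]
lemmas relations_uminus = F.submoduleE(3)[OF relations_submodule]

lemma relations_minus: "v \<in> relations \<Longrightarrow> w \<in> relations \<Longrightarrow> v \<ominus>\<^bsub>F\<^esub> w \<in> relations"
  unfolding a_minus_def by (intro relations_add relations_uminus)

lemma rel_endosD:
  assumes "B \<in> rel_endos"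
  shows "B \<in> mod_hom R F F" "z \<in> carrier F \<Longrightarrow> B z \<in> relations" "z \<in> carrier F \<Longrightarrow> B z \<in> carrier F"
  using assms relations_closed unfolding rel_endos_def by auto

lemma rel_endos_comp:
  assumes "C \<in> rel_endos" "f \<in> mod_hom R F F"
  shows "(\<lambda>z. C (f z)) \<in> rel_endos"
  using assms mod_hom_comp[OF assms(2) rel_endosD(1)[OF assms(1)]] mod_homD(1)[OF assms(2)]
  unfolding rel_endos_def by auto

lemma rel_endos_add:
  assumes "C \<in> rel_endos" "B \<in> rel_endos"
  shows "(\<lambda>z. C z \<oplus>\<^bsub>F\<^esub> B z) \<in> rel_endos"
  unfolding rel_endos_def
  using FF.mod_hom_add[OF rel_endosD(1)[OF assms(1)] rel_endosD(1)[OF assms(2)]]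
    relations_add[OF rel_endosD(2)[OF assms(1)] rel_endosD(2)[OF assms(2)]] by blast

lemma rel_endos_minus:
  assumes "C \<in> rel_endos" "B \<in> rel_endos"
  shows "(\<lambda>z. C z \<ominus>\<^bsub>F\<^esub> B z) \<in> rel_endos"
  unfolding rel_endos_def
  using FF.mod_hom_minus_fun[OF rel_endosD(1)[OF assms(1)] rel_endosD(1)[OF assms(2)]]
    relations_minus[OF rel_endosD(2)[OF assms(1)] rel_endosD(2)[OF assms(2)]] by blast

lemma unit_vec_F: "unit_vec R A x \<in> carrier F"
  using unit_vec_closed[OF R.is_cring] by simp

lemma minus_apply: "v \<in> carrier F \<Longrightarrow> w \<in> carrier F \<Longrightarrow> x \<in> A \<Longrightarrow> (v \<ominus>\<^bsub>F\<^esub> w) x = v x \<ominus> w x"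
  using a_minus_vec_module[OF ring_module_module[OF R.is_cring], of v A w x]
  by (simp add: a_minus_def[of "restrict_scalars R (\<lambda>x. x)"] a_minus_def[of R])

text \<open>The congruence of \<open>B w\<close> and \<open>w\<close> is taken in \<open>F\<close>
  modulo \<open>I F\<close>, not in \<open>K\<close> modulo \<open>I K\<close>. Read on coordinates,
  it survives enlarging \<open>I\<close> and intersecting a family of ideals.\<close>

definition splits_at where
  "splits_at B I \<longleftrightarrow> (\<forall>w\<in>relations. \<forall>x\<in>A. (B w \<ominus>\<^bsub>F\<^esub> w) x \<in> I)"

end

text \<open>The assumption is purity of \<open>K\<close> in \<open>F\<close> for one relation at a
  time, a form of the equational criterion for flatness.\<close>

locale pure_presentation = presentation +
  assumes relation_fixed: "w \<in> relations \<Longrightarrow> \<exists>C\<in>rel_endos. C w = w"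
begin

text \<open>One relation is added at a time: the defect of \<open>C\<close> at the new relation is
  itself a relation, so some \<open>D\<close> fixes that defect.\<close>

lemma finite_relations_fixed:
  assumes "finite V" "V \<subseteq> relations"
  shows "\<exists>C\<in>rel_endos. \<forall>v\<in>V. C v = v"
  using assms
proof (induction V rule: finite_induct)
  case empty
  then show ?case using relation_fixed F.submoduleE(2)[OF relations_submodule] by auto
next
  case (insert w V)
  then obtain C where C: "C \<in> rel_endos" "\<And>v. v \<in> V \<Longrightarrow> C v = v" by auto
  have w: "w \<in> relations" "w \<in> carrier F" using insert.prems relations_closed by auto
  have Cw: "C w \<in> relations" "C w \<in> carrier F" using rel_endosD[OF C(1)] w by auto
  obtain D where D: "D \<in> rel_endos" "D (w \<ominus>\<^bsub>F\<^esub> C w) = w \<ominus>\<^bsub>F\<^esub> C w"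
    using relation_fixed[OF relations_minus[OF w(1) Cw(1)]] by blast
  \<comment> \<open>Chosen so that 1 - \<open>?E\<close> = (1 - \<open>D\<close>)(1 -
    \<open>C\<close>): the right factor kills \<open>V\<close>, and the left factor kills what the
    right one leaves of \<open>w\<close>.\<close>
  let ?E = "\<lambda>z. C z \<oplus>\<^bsub>F\<^esub> (D z \<ominus>\<^bsub>F\<^esub> D (C z))"
  have E: "?E \<in> rel_endos"
    using rel_endos_add[OF C(1) rel_endos_minus[OF D(1) rel_endos_comp[OF D(1) rel_endosD(1)[OF C(1)]]]] .
  have EV: "?E v = v" if "v \<in> V" for v
  proof -
    have "v \<in> carrier F" using that insert.prems relations_closed by auto
    then show ?thesis using C(2)[OF that] rel_endosD(3)[OF D(1)] F.r_zero[of v] F.r_neg[of "D v"] by (simp add: a_minus_def del: vec_module_simps)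
  qed
  have Ew: "?E w = w"
  proof -
    have "?E w = C w \<oplus>\<^bsub>F\<^esub> D (w \<ominus>\<^bsub>F\<^esub> C w)"
      using FF.mod_hom_diff[OF rel_endosD(1)[OF D(1)]] w Cw by simp
    also have "\<dots> = C w \<oplus>\<^bsub>F\<^esub> (w \<ominus>\<^bsub>F\<^esub> C w)" by (simp only: D(2))
    also have "\<dots> = w" using w(2) Cw(2)
      by (metis F.a_comm F.a_inv_closed F.add.inv_closed F.l_neg F.a_assoc F.r_zero a_minus_def)
    finally show ?thesis .
  qed
  show ?case
  proof (intro bexI[OF _ E] ballI)
    show "?E v = v" if "v \<in> insert w V" for v
      using that by (rule insertE) (simp only: Ew, erule EV)
  qed
qed

text \<open>Writing \<open>N = C - BC\<close>, where \<open>C\<close> fixes \<open>w\<close> and the image of \<open>B\<close>, gives \<open>N w = w - B w\<close> and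
  \<open>N B = B (1 - B)\<close>. So \<open>N\<close> preserves the image of \<open>B\<close> and fixes \<open>w\<close> modulo it, while its matrix
  vanishes modulo \<open>p\<close>.\<close>

lemma splits_locally:
  assumes p: "primeideal p R" and B: "B \<in> rel_endos" "splits_at B p"
    and B': "B' \<in> rel_endos" "\<And>z. z \<in> carrier F \<Longrightarrow> B' (B z) = B z" and w: "w \<in> relations"
  shows "\<exists>r\<in>carrier R - p. r \<odot>\<^bsub>F\<^esub> (B' w \<ominus>\<^bsub>F\<^esub> w) = \<zero>\<^bsub>F\<^esub>"
proof -
  note Bh = rel_endosD(1)[OF B(1)] and Bc = rel_endosD(3)[OF B(1)] and B'h = rel_endosD(1)[OF B'(1)]
  have wF: "w \<in> carrier F" using w relations_closed by blast
  \<comment> \<open>The values of \<open>B\<close> on unit vectors span its image, so fixing these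
    finitely many relations makes \<open>C\<close> the identity on all of it.\<close>
  have "finite (insert w ((\<lambda>x. B (unit_vec R A x)) ` A))" using fin by simp
  then obtain C where C: "C \<in> rel_endos" "C w = w" "\<And>x. x \<in> A \<Longrightarrow> C (B (unit_vec R A x)) = B (unit_vec R A x)"
    using finite_relations_fixed[of "insert w ((\<lambda>x. B (unit_vec R A x)) ` A)"] w
      rel_endosD(2)[OF B(1) unit_vec_F] by auto
  note Ch = rel_endosD(1)[OF C(1)] and Cc = rel_endosD(3)[OF C(1)]
  have CB: "C (B z) = B z" if "z \<in> carrier F" for z
    using F.mod_hom_free_module_cong[OF fin mod_hom_comp[OF Bh Ch] Bh C(3)] that by simp
  define N where "N = (\<lambda>z. C z \<ominus>\<^bsub>F\<^esub> B (C z))"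
  have N: "N \<in> mod_hom R F F" unfolding N_def by (intro FF.mod_hom_minus_fun mod_hom_comp[OF Ch Bh] Ch)
  \<comment> \<open>\<open>N z\<close> is \<open>C z - B (C z)\<close>, and \<open>C z\<close> is a
    relation, so the splitting of \<open>B\<close> at \<open>p\<close> applies to it for every
    \<open>z\<close>, although \<open>z\<close> is arbitrary.\<close>
  have Np: "N z x \<in> p" if "z \<in> carrier F" "x \<in> A" for z x
  proof -
    interpret p: primeideal p R by (rule p)
    have Cz: "C z \<in> relations" using rel_endosD(2)[OF C(1) that(1)] .
    then have "(B (C z) \<ominus>\<^bsub>F\<^esub> C z) x \<in> p" using B(2) that(2) unfolding splits_at_def by blast
    then have "\<ominus> ((B (C z) \<ominus>\<^bsub>F\<^esub> C z) x) \<in> p" by (rule p.a_inv_closed)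
    moreover have "\<ominus> ((B (C z) \<ominus>\<^bsub>F\<^esub> C z) x) = N z x"
    proof -
      have c: "C z \<in> carrier F" "B (C z) \<in> carrier F" using Cz relations_closed Bc by auto
      then have "C z x \<in> carrier R" "B (C z) x \<in> carrier R" using that(2) by auto
      then show ?thesis unfolding N_def using minus_apply c that(2)
        by (simp add: a_minus_def R.minus_add R.a_comm)
    qed
    ultimately show ?thesis by simp
  qed
  have "\<exists>f r. F.operator_poly N f r \<and> r \<notin> p \<and> (\<forall>i\<in>A. f (unit_vec R A i) = \<zero>\<^bsub>F\<^esub>)"
  proof (rule F.operator_poly_annihilates[OF N p fin, where n = "\<lambda>i. N (unit_vec R A i)"])
    show "unit_vec R A \<in> A \<rightarrow> carrier F" using unit_vec_F by blast
    show "N (unit_vec R A i) j \<in> p" if "i \<in> A" "j \<in> A" for i j using Np[OF unit_vec_F that(2)] .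
    show "N (unit_vec R A i) = (\<Oplus>\<^bsub>F\<^esub>j\<in>A. N (unit_vec R A i) j \<odot>\<^bsub>F\<^esub> unit_vec R A j)"
      if "i \<in> A" for i
      using R.lincomb_unit_vecs[OF fin, of "N (unit_vec R A i)"] mod_homD(1)[OF N unit_vec_F[of i]]
      unfolding lincomb_def by (simp del: vec_module_simps(4))
  qed
  then obtain f r where f: "F.operator_poly N f r" "r \<notin> p" "\<And>i. i \<in> A \<Longrightarrow> f (unit_vec R A i) = \<zero>\<^bsub>F\<^esub>"
    by blast
  note fh = F.operator_poly_hom[OF N f(1)]
  have r: "r \<in> carrier R" by (rule fh(2))
  have zh: "(\<lambda>z. \<zero>\<^bsub>F\<^esub>) \<in> mod_hom R F F" by (intro mod_homI) (auto simp del: vec_module_simps)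
  have f0: "f w = \<zero>\<^bsub>F\<^esub>" using F.mod_hom_free_module_cong[OF fin fh(1) zh f(3), of w] wF by (simp del: vec_module_simps(2))
  have im: "submodule (B ` carrier F) R F" by (rule FF.mod_hom_image_submodule[OF Bh])
  have "N ` (B ` carrier F) \<subseteq> B ` carrier F"
  proof clarify
    fix z assume z: "z \<in> carrier F"
    have "N (B z) = B (z \<ominus>\<^bsub>F\<^esub> B z)"
      unfolding N_def using CB z Bc FF.mod_hom_diff[OF Bh] by simp
    then show "N (B z) \<in> B ` carrier F" using z Bc F.minus_closed by blast
  qed
  moreover have "N w \<ominus>\<^bsub>F\<^esub> w \<in> B ` carrier F"
  proof -
    have "N w \<ominus>\<^bsub>F\<^esub> w = \<ominus>\<^bsub>F\<^esub> B w"
      unfolding N_def C(2) a_minus_def using wF Bc[OF wF]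
      by (metis F.a_comm F.a_assoc F.add.inv_closed F.r_neg F.r_zero)
    then show ?thesis using F.submoduleE(3)[OF im] wF by (metis imageI)
  qed
  \<comment> \<open>\<open>f\<close> vanishes on unit vectors, hence at \<open>w\<close>, while
    modulo the image of \<open>B\<close> it multiplies \<open>w\<close> by \<open>r\<close>.
    Therefore \<open>r w\<close> lies in the image of \<open>B\<close>, where \<open>B'\<close> is
    the identity, and \<open>r (B' w - w)\<close> vanishes.\<close>
  ultimately have "f w \<ominus>\<^bsub>F\<^esub> r \<odot>\<^bsub>F\<^esub> w \<in> B ` carrier F"
    using F.operator_poly_value[OF N f(1) im _ wF] by blast
  then have "\<ominus>\<^bsub>F\<^esub> (\<zero>\<^bsub>F\<^esub> \<ominus>\<^bsub>F\<^esub> r \<odot>\<^bsub>F\<^esub> w) \<in> B ` carrier F"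
    using F.submoduleE(3)[OF im] f0 by metis
  moreover have rw: "r \<odot>\<^bsub>F\<^esub> w \<in> carrier F" using r wF by (rule F.smult_closed)
  then have "\<ominus>\<^bsub>F\<^esub> (\<zero>\<^bsub>F\<^esub> \<ominus>\<^bsub>F\<^esub> r \<odot>\<^bsub>F\<^esub> w) = r \<odot>\<^bsub>F\<^esub> w"
    unfolding a_minus_def by (metis F.add.inv_closed F.l_zero F.minus_minus)
  ultimately obtain z where z: "z \<in> carrier F" "r \<odot>\<^bsub>F\<^esub> w = B z" by auto
  have B'w: "B' w \<in> carrier F" using rel_endosD(3)[OF B'(1) wF] .
  have "r \<odot>\<^bsub>F\<^esub> B' w = r \<odot>\<^bsub>F\<^esub> w"
    using B'(2)[OF z(1)] mod_homD(3)[OF B'h r wF] z(2) by simp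
  then have "r \<odot>\<^bsub>F\<^esub> (B' w \<ominus>\<^bsub>F\<^esub> w) = \<zero>\<^bsub>F\<^esub>"
    using r wF B'w rw F.smult_r_distr[OF r B'w F.a_inv_closed[OF wF]] F.smult_r_minus[OF r wF] F.r_neg[OF rw]
    unfolding a_minus_def by metis
  then show ?thesis using r f(2) by blast
qed

end

section \<open>Splitting the relations\<close>

lemma (in cring) ideal_subset_maximalideal:
  assumes J: "ideal J R" and one: "\<one> \<notin> J"
  shows "\<exists>m. maximalideal m R \<and> J \<subseteq> m"
proof -
  let ?P = "{I. ideal I R \<and> J \<subseteq> I \<and> \<one> \<notin> I}"
  have "\<exists>m\<in>?P. \<forall>X\<in>?P. m \<subseteq> X \<longrightarrow> X = m"
  proof (rule subset_Zorn_nonempty)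
    show "?P \<noteq> {}" using J one by blast
    fix C assume C: "C \<noteq> {}" "subset.chain ?P C"
    then have "subset.chain {I. ideal I R} C" unfolding subset.chain_def by blast
    from chain_Union_is_ideal[OF this] have "ideal (\<Union>C) R" using C by simp
    then show "\<Union>C \<in> ?P" using C unfolding subset.chain_def by blast
  qed
  then obtain m where "m \<in> ?P" and max: "\<forall>X\<in>?P. m \<subseteq> X \<longrightarrow> X = m" by (rule bexE)
  then have m: "ideal m R" "J \<subseteq> m" "\<one> \<notin> m" by simp_all
  have "maximalideal m R"
  proof (rule maximalidealI)
    show "carrier R \<noteq> m" using m(3) by blast
    show "I = m \<or> I = carrier R" if "ideal I R" "m \<subseteq> I" for I
    proof (cases "\<one> \<in> I")
      case True
      then show ?thesis using ideal.one_imp_carrier[OF that(1)] by simp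
    next
      case False
      then have "I \<in> ?P" using that m(2) by auto
      then show ?thesis using max that(2) by simp
    qed
  qed (rule m(1))
  then show ?thesis using m(2) by blast
qed

lemma (in abelian_group) minus_eq_zeroD:
  assumes "x \<ominus> y = \<zero>" "x \<in> carrier G" "y \<in> carrier G"
  shows "x = y"
  using minus_equality[of x "\<ominus> y"] assms by (simp add: a_minus_def)

lemma (in module) annihilator_ideal:
  assumes "v \<in> carrier M"
  shows "ideal {s \<in> carrier R. s \<odot>\<^bsub>M\<^esub> v = \<zero>\<^bsub>M\<^esub>} R"
proof (rule idealI)
  show "ring R" by (rule R.ring_axioms)
  show "subgroup {s \<in> carrier R. s \<odot>\<^bsub>M\<^esub> v = \<zero>\<^bsub>M\<^esub>} (add_monoid R)"
    using assms by (intro R.add.subgroupI) (auto simp: smult_l_distr smult_l_minus simp flip: a_inv_def)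
  fix a x assume a: "a \<in> {s \<in> carrier R. s \<odot>\<^bsub>M\<^esub> v = \<zero>\<^bsub>M\<^esub>}" and x: "x \<in> carrier R"
  then show "x \<otimes> a \<in> {s \<in> carrier R. s \<odot>\<^bsub>M\<^esub> v = \<zero>\<^bsub>M\<^esub>}"
    using assms by (simp add: smult_assoc1)
  then show "a \<otimes> x \<in> {s \<in> carrier R. s \<odot>\<^bsub>M\<^esub> v = \<zero>\<^bsub>M\<^esub>}"
    using a x by (simp add: R.m_comm)
qed

context pure_presentation
begin

text \<open>The image of \<open>B\<close> is spanned by finitely many relations even if
  \<open>K\<close> is not, so purity for finite sets of relations is enough.\<close>

lemma rel_endo_absorbed:
  assumes B: "B \<in> rel_endos"
  shows "\<exists>B'\<in>rel_endos. \<forall>z\<in>carrier F. B' (B z) = B z"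
proof -
  have "\<exists>C\<in>rel_endos. \<forall>v\<in>(\<lambda>x. B (unit_vec R A x)) ` A. C v = v"
    using fin rel_endosD(2)[OF B unit_vec_F] by (intro finite_relations_fixed) auto
  then obtain C where C: "C \<in> rel_endos" "\<And>x. x \<in> A \<Longrightarrow> C (B (unit_vec R A x)) = B (unit_vec R A x)"
    by blast
  have "C (B z) = B z" if "z \<in> carrier F" for z
    using F.mod_hom_free_module_cong[OF fin mod_hom_comp[OF rel_endosD(1)[OF B] rel_endosD(1)[OF C(1)]]
      rel_endosD(1)[OF B] C(2)] that by simp
  then show ?thesis using C(1) by blast
qed

text \<open>Going up from \<open>p\<close> to \<open>m\<close> keeps \<open>B\<close>, since the
  ideal only grows. Going down from \<open>m\<close> to \<open>q\<close> uses the element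
  \<open>r\<close> of \<open>splits_locally\<close>: it lies outside \<open>m\<close>, hence outside
  \<open>q\<close>, and it kills the coordinates of \<open>B' w - w\<close>, so primality puts these
  in \<open>q\<close>. The same \<open>B'\<close> serves all of \<open>X\<close>, as it depends only
  on \<open>B\<close>.\<close>

lemma splits_at_cone:
  assumes B: "B \<in> rel_endos" and X: "\<And>p. p \<in> X \<Longrightarrow> splits_at B p"
  shows "\<exists>B'\<in>rel_endos. \<forall>q\<in>generalization_cone R (specialization_cone R X). splits_at B' q"
proof -
  obtain B' where B': "B' \<in> rel_endos" "\<And>z. z \<in> carrier F \<Longrightarrow> B' (B z) = B z"
    using rel_endo_absorbed[OF B] by blast
  have "splits_at B' q" if q: "q \<in> generalization_cone R (specialization_cone R X)" for q
    unfolding splits_at_def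
  proof (intro ballI)
    fix w x assume w: "w \<in> relations" and x: "x \<in> A"
    obtain p m where pm: "p \<in> X" "p \<subseteq> m" "primeideal m R" "q \<subseteq> m" "primeideal q R"
      using q unfolding generalization_cone_def specialization_cone_def Spec_def by blast
    have Bm: "splits_at B m" using X[OF pm(1)] pm(2) unfolding splits_at_def by blast
    obtain r where r: "r \<in> carrier R - m" "r \<odot>\<^bsub>F\<^esub> (B' w \<ominus>\<^bsub>F\<^esub> w) = \<zero>\<^bsub>F\<^esub>"
      using splits_locally[OF pm(3) B Bm B' w] by (rule bexE)
    interpret qp: primeideal q R by (rule pm(5))
    have "B' w \<ominus>\<^bsub>F\<^esub> w \<in> carrier F"
      using w relations_closed rel_endosD(3)[OF B'(1)] by (intro F.minus_closed) auto
    then have c: "(B' w \<ominus>\<^bsub>F\<^esub> w) x \<in> carrier R" using x by auto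
    have "(r \<odot>\<^bsub>F\<^esub> (B' w \<ominus>\<^bsub>F\<^esub> w)) x = \<zero>" using r(2) x by simp
    then have "r \<otimes> (B' w \<ominus>\<^bsub>F\<^esub> w) x \<in> q" using x by simp
    then show "(B' w \<ominus>\<^bsub>F\<^esub> w) x \<in> q" using qp.I_prime[OF _ c] r(1) pm(4) by blast
  qed
  then show ?thesis using B'(1) by blast
qed

lemma splits_at_iterated_cone:
  assumes "B \<in> rel_endos" "\<And>p. p \<in> X \<Longrightarrow> splits_at B p"
  shows "\<exists>B'\<in>rel_endos. \<forall>q\<in>iterated_cone R n X. splits_at B' q"
proof (induction n)
  case 0
  then show ?case using assms by (auto simp: iterated_cone_def)
next
  case (Suc n)
  then show ?case using splits_at_cone[of _ "iterated_cone R n X"] by (auto simp: iterated_cone_def)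
qed

text \<open>For every relation \<open>w\<close> the annihilator of \<open>B' w - w\<close> has, by
  \<open>splits_locally\<close>, an element outside each maximal ideal, so it is the whole
  ring.\<close>

lemma splits_globally:
  assumes B: "B \<in> rel_endos" and m: "\<And>m. maximalideal m R \<Longrightarrow> splits_at B m"
  shows "\<exists>B'\<in>rel_endos. \<forall>w\<in>relations. B' w = w"
proof -
  obtain B' where B': "B' \<in> rel_endos" "\<And>z. z \<in> carrier F \<Longrightarrow> B' (B z) = B z"
    using rel_endo_absorbed[OF B] by blast
  have "B' w = w" if w: "w \<in> relations" for w
  proof -
    have wF: "w \<in> carrier F" "B' w \<in> carrier F" using w relations_closed rel_endosD(3)[OF B'(1)] by auto
    let ?v = "B' w \<ominus>\<^bsub>F\<^esub> w"
    let ?J = "{s \<in> carrier R. s \<odot>\<^bsub>F\<^esub> ?v = \<zero>\<^bsub>F\<^esub>}"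
    have v: "?v \<in> carrier F" using wF by (intro F.minus_closed)
    have J: "ideal ?J R" using F.annihilator_ideal[OF v] .
    have "\<one> \<in> ?J"
    proof (rule ccontr)
      assume "\<one> \<notin> ?J"
      then obtain m' where m': "maximalideal m' R" "?J \<subseteq> m'" using R.ideal_subset_maximalideal[OF J] by blast
      then show False using splits_locally[OF R.maximalideal_prime[OF m'(1)] B m[OF m'(1)] B' w] by blast
    qed
    then have "\<one> \<odot>\<^bsub>F\<^esub> ?v = \<zero>\<^bsub>F\<^esub>" by (simp only: mem_Collect_eq)
    then have "?v = \<zero>\<^bsub>F\<^esub>" by (simp only: F.smult_one[OF v])
    then show ?thesis using wF F.minus_eq_zeroD by blast
  qed
  then show ?thesis using B'(1) by blast
qed

text \<open>The coordinates of \<open>B' w - w\<close> lie in every prime of the iterated cone,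
  hence in the Jacobson radical and in every maximal ideal. The primes of the cone need not be
  comparable with the maximal ideals: only the intersection is used.\<close>

lemma split_if_inter_subset_jacobson_radical:
  assumes "B \<in> rel_endos" "\<And>p. p \<in> X \<Longrightarrow> splits_at B p"
    and jac: "ideal_Inter R (iterated_cone R n X) \<subseteq> jacobson_radical R"
  shows "\<exists>B'\<in>rel_endos. \<forall>w\<in>relations. B' w = w"
proof -
  obtain B' where B': "B' \<in> rel_endos" "\<And>q. q \<in> iterated_cone R n X \<Longrightarrow> splits_at B' q"
    using splits_at_iterated_cone[OF assms(1,2)] by blast
  show ?thesis
  proof (rule splits_globally[OF B'(1)])
    fix m assume m: "maximalideal m R"
    show "splits_at B' m" unfolding splits_at_def
    proof (intro ballI)
      fix w x assume w: "w \<in> relations" and x: "x \<in> A"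
      have "B' w \<ominus>\<^bsub>F\<^esub> w \<in> carrier F"
        using w relations_closed rel_endosD(3)[OF B'(1)] by (intro F.minus_closed) auto
      then have "(B' w \<ominus>\<^bsub>F\<^esub> w) x \<in> ideal_Inter R (iterated_cone R n X)"
        using B'(2) w x unfolding ideal_Inter_def splits_at_def by auto
      then show "(B' w \<ominus>\<^bsub>F\<^esub> w) x \<in> m"
        using jac m unfolding jacobson_radical_def ideal_Inter_def by blast
    qed
  qed
qed

end

section \<open>Projectivity from a projection onto the relations\<close>

context presentation
begin

text \<open>\<open>B\<close> is a projection of \<open>F\<close> onto \<open>K\<close>, so 1 -
  \<open>B\<close> descends to a linear section of the map from \<open>F\<close> to
  \<open>M\<close>. Lifting is then done on the free module \<open>F\<close> and pulled back along
  this section.\<close>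

lemma projective_if_split:
  assumes B: "B \<in> rel_endos" "\<And>w. w \<in> relations \<Longrightarrow> B w = w"
  shows "projective_module TYPE('u) TYPE('v) R M"
proof -
  have "\<exists>h\<in>mod_hom R M N. \<forall>x\<in>carrier M. g (h x) = f x"
    if N: "module R N" "module R N'" and g: "g \<in> mod_hom R N N'" and
      surj: "g ` carrier N = carrier N'" and f: "f \<in> mod_hom R M N'"
    for N :: "('a, 'u) module" and N' :: "('a, 'v) module" and g f
  proof -
    interpret N: module R N by (rule N(1))
    interpret N': module R N' by (rule N(2))
    interpret FN: module_pair R F N unfolding module_pair_def using F.module_axioms N by blast
    interpret MN': module_pair R M N' unfolding module_pair_def using module_axioms N by blast
    let ?\<pi> = "lincomb M A (\<lambda>x. x)"
    have "\<exists>n\<in>carrier N. g n = f x" if "x \<in> A" for x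
    proof -
      have "f x \<in> g ` carrier N" unfolding surj using mod_homD(1)[OF f] sub that by blast
      then show ?thesis by auto
    qed
    then obtain n where n: "\<And>x. x \<in> A \<Longrightarrow> n x \<in> carrier N" "\<And>x. x \<in> A \<Longrightarrow> g (n x) = f x" by metis
    let ?L = "lincomb N A n"
    have L: "?L \<in> mod_hom R F N" using fin n by (intro N.lincomb_hom) auto
    have gLe: "g (?L (unit_vec R A x)) = f (?\<pi> (unit_vec R A x))" if "x \<in> A" for x
    proof -
      have "n \<in> A \<rightarrow> carrier N" "(\<lambda>x. x) \<in> A \<rightarrow> carrier M" using n(1) sub by auto
      then show ?thesis using n(2) that fin by (simp add: N.lincomb_unit_vec lincomb_unit_vec)
    qed
    have gL: "g (?L z) = f (?\<pi> z)" if "z \<in> carrier F" for z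
      using N'.mod_hom_free_module_cong[OF fin mod_hom_comp[OF L g] mod_hom_comp[OF presentation_hom f] gLe]
        that by simp
    \<comment> \<open>The lift \<open>?L\<close> over \<open>F\<close> need not vanish on relations;
      precomposing with 1 - \<open>B\<close> forces this and changes nothing after applying
      \<open>g\<close>, because \<open>B z\<close> is zero in \<open>M\<close>.\<close>
    let ?Q = "\<lambda>z. ?L (z \<ominus>\<^bsub>F\<^esub> B z)"
    have idh: "(\<lambda>z. z) \<in> mod_hom R F F" by (intro mod_homI) auto
    have Q: "?Q \<in> mod_hom R F N"
      using mod_hom_comp[OF FF.mod_hom_minus_fun[OF idh rel_endosD(1)[OF B(1)]] L] .
    have Q0: "?Q w = \<zero>\<^bsub>N\<^esub>" if "w \<in> relations" for w
      using B(2)[OF that] FN.mod_hom_zero[OF L] F.r_neg[of w] relations_closed[OF that]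
      by (simp add: a_minus_def del: vec_module_simps)
    have wd: "?Q z = ?Q z'" if z: "z \<in> carrier F" "z' \<in> carrier F" "?\<pi> z = ?\<pi> z'" for z z'
    proof -
      have "z \<ominus>\<^bsub>F\<^esub> z' \<in> relations"
        using z FM.mod_hom_diff[OF presentation_hom z(1,2)] F.minus_closed[OF z(1,2)] mod_homD(1)[OF presentation_hom z(2)]
        unfolding relations_def by (simp add: M.r_neg a_minus_def[of M])
      then have "?Q z \<ominus>\<^bsub>N\<^esub> ?Q z' = \<zero>\<^bsub>N\<^esub>" using Q0 FN.mod_hom_diff[OF Q z(1,2)] by simp
      then show ?thesis using mod_homD(1)[OF Q] z N.minus_eq_zeroD by blast
    qed
    \<comment> \<open>\<open>s\<close> is a mere choice of preimages, not linear; linearity of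
      \<open>?Q (s m)\<close> in \<open>m\<close> comes from \<open>wd\<close>, by which
      \<open>?Q\<close> depends only on the image in \<open>M\<close>.\<close>
    obtain s where s: "\<And>m. m \<in> carrier M \<Longrightarrow> s m \<in> carrier F" "\<And>m. m \<in> carrier M \<Longrightarrow> ?\<pi> (s m) = m"
      using onto by metis
    note \<pi>D = mod_homD[OF presentation_hom]
    have h: "(\<lambda>m. ?Q (s m)) \<in> mod_hom R M N"
    proof (rule mod_homI)
      show "?Q (s m) \<in> carrier N" if "m \<in> carrier M" for m using mod_homD(1)[OF Q] s(1)[OF that] .
      fix m assume m: "m \<in> carrier M"
      show "?Q (s (m \<oplus>\<^bsub>M\<^esub> m')) = ?Q (s m) \<oplus>\<^bsub>N\<^esub> ?Q (s m')" if m': "m' \<in> carrier M" for m'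
      proof -
        have "?Q (s (m \<oplus>\<^bsub>M\<^esub> m')) = ?Q (s m \<oplus>\<^bsub>F\<^esub> s m')"
          using m m' s \<pi>D(2) by (intro wd F.a_closed) auto
        then show ?thesis using mod_homD(2)[OF Q s(1)[OF m] s(1)[OF m']] by simp
      qed
      show "?Q (s (r \<odot>\<^bsub>M\<^esub> m)) = r \<odot>\<^bsub>N\<^esub> ?Q (s m)" if r: "r \<in> carrier R" for r
      proof -
        have "?Q (s (r \<odot>\<^bsub>M\<^esub> m)) = ?Q (r \<odot>\<^bsub>F\<^esub> s m)"
          using m r s \<pi>D(3) by (intro wd F.smult_closed) auto
        then show ?thesis using mod_homD(3)[OF Q r s(1)[OF m]] by simp
      qed
    qed
    have gh: "g (?Q (s m)) = f m" if m: "m \<in> carrier M" for m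
    proof -
      note sm = s(1)[OF m]
      have Bs: "B (s m) \<in> relations" "B (s m) \<in> carrier F" using rel_endosD[OF B(1)] sm by auto
      have "g (?Q (s m)) = f (?\<pi> (s m \<ominus>\<^bsub>F\<^esub> B (s m)))" by (rule gL) (intro F.minus_closed sm Bs)
      also have "?\<pi> (s m \<ominus>\<^bsub>F\<^esub> B (s m)) = m \<ominus>\<^bsub>M\<^esub> \<zero>\<^bsub>M\<^esub>"
        using FM.mod_hom_diff[OF presentation_hom sm Bs(2)] Bs(1) s(2)[OF m] unfolding relations_def by simp
      also have "\<dots> = m" using m M.minus_equality[of "\<zero>\<^bsub>M\<^esub>" "\<zero>\<^bsub>M\<^esub>"] by (simp add: a_minus_def)
      finally show ?thesis .
    qed
    show ?thesis by (rule bexI[OF _ h]) (rule ballI, rule gh)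
  qed
  then show ?thesis unfolding projective_module_def using module_axioms by blast
qed

end

section \<open>Right exactness of the tensor product\<close>

text \<open>The pure tensor of \<open>z\<close> and \<open>n\<close>, seen in N^A through the
  isomorphism of R^A tensor N with N^A.\<close>

definition vec_tensor :: "('r, 'n, 'c) module_scheme \<Rightarrow> 'i set \<Rightarrow> ('i \<Rightarrow> 'r) \<Rightarrow> 'n \<Rightarrow> 'i \<Rightarrow> 'n" where
  "vec_tensor N A z n = (\<lambda>x\<in>A. z x \<odot>\<^bsub>N\<^esub> n)"

context presentation
begin

text \<open>The image of K tensor N in N^A. Sums of pure tensors suffice: negatives and scalar
  multiples can be moved into \<open>k\<close> or \<open>n\<close>.\<close>

inductive_set relation_span :: "('a, 'n, 'k) module_scheme \<Rightarrow> ('c \<Rightarrow> 'n) set"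
  for N :: "('a, 'n, 'k) module_scheme" where
  zero: "\<zero>\<^bsub>vec_module A N\<^esub> \<in> relation_span N"
| gen: "k \<in> relations \<Longrightarrow> n \<in> carrier N \<Longrightarrow> vec_tensor N A k n \<in> relation_span N"
| add: "u \<in> relation_span N \<Longrightarrow> v \<in> relation_span N \<Longrightarrow> u \<oplus>\<^bsub>vec_module A N\<^esub> v \<in> relation_span N"

context
  fixes N :: "('a, 'n, 'k) module_scheme"
  assumes N: "module R N"
begin

interpretation N: module R N by (rule N)
interpretation V: module R "vec_module A N" by (rule vec_module_module) (rule N)

lemma vec_tensor_closed: "z \<in> carrier F \<Longrightarrow> n \<in> carrier N \<Longrightarrow> vec_tensor N A z n \<in> carrier (vec_module A N)"
  by (auto simp: vec_tensor_def)

lemma vec_tensor_add_left: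
  "z \<in> carrier F \<Longrightarrow> w \<in> carrier F \<Longrightarrow> n \<in> carrier N \<Longrightarrow>
    vec_tensor N A (z \<oplus>\<^bsub>F\<^esub> w) n = vec_tensor N A z n \<oplus>\<^bsub>vec_module A N\<^esub> vec_tensor N A w n"
  by (auto simp: vec_tensor_def fun_eq_iff PiE_iff N.smult_l_distr)

lemma vec_tensor_uminus_left:
  assumes "z \<in> carrier F" "n \<in> carrier N"
  shows "vec_tensor N A (\<ominus>\<^bsub>F\<^esub> z) n = \<ominus>\<^bsub>vec_module A N\<^esub> vec_tensor N A z n"
proof (rule V.minus_equality[symmetric])
  note nz = F.a_inv_closed[OF assms(1)]
  show "vec_tensor N A z n \<in> carrier (vec_module A N)" "vec_tensor N A (\<ominus>\<^bsub>F\<^esub> z) n \<in> carrier (vec_module A N)"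
    using vec_tensor_closed[OF assms] vec_tensor_closed[OF nz assms(2)] .
  have "vec_tensor N A \<zero>\<^bsub>F\<^esub> n = \<zero>\<^bsub>vec_module A N\<^esub>"
    using assms(2) by (auto simp: vec_tensor_def fun_eq_iff)
  then show "vec_tensor N A (\<ominus>\<^bsub>F\<^esub> z) n \<oplus>\<^bsub>vec_module A N\<^esub> vec_tensor N A z n = \<zero>\<^bsub>vec_module A N\<^esub>"
    using vec_tensor_add_left[OF nz assms] F.l_neg[OF assms(1)] by simp
qed

lemma vec_tensor_add_right:
  "z \<in> carrier F \<Longrightarrow> n \<in> carrier N \<Longrightarrow> n' \<in> carrier N \<Longrightarrow>
    vec_tensor N A z (n \<oplus>\<^bsub>N\<^esub> n') = vec_tensor N A z n \<oplus>\<^bsub>vec_module A N\<^esub> vec_tensor N A z n'"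
  by (auto simp: vec_tensor_def fun_eq_iff PiE_iff N.smult_r_distr)

lemma vec_tensor_smult:
  "z \<in> carrier F \<Longrightarrow> n \<in> carrier N \<Longrightarrow> r \<in> carrier R \<Longrightarrow>
    vec_tensor N A (r \<odot>\<^bsub>F\<^esub> z) n = vec_tensor N A z (r \<odot>\<^bsub>N\<^esub> n)"
  by (auto simp: vec_tensor_def fun_eq_iff PiE_iff N.smult_assoc1[symmetric] R.m_comm)

lemma relation_span_closed: "u \<in> relation_span N \<Longrightarrow> u \<in> carrier (vec_module A N)"
proof (induction rule: relation_span.induct)
  case (gen k n) then show ?case using vec_tensor_closed relations_closed by blast
next
  case (add u v) show ?case using add.IH by (rule V.a_closed)
qed (rule V.zero_closed)

lemma relation_span_uminus: "u \<in> relation_span N \<Longrightarrow> \<ominus>\<^bsub>vec_module A N\<^esub> u \<in> relation_span N"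
proof (induction rule: relation_span.induct)
  case zero then show ?case using relation_span.zero using V.minus_equality[OF V.l_zero[OF V.zero_closed] V.zero_closed V.zero_closed] by (simp only:)
next
  case (gen k n)
  then show ?case using vec_tensor_uminus_left[of k n] relations_closed relations_uminus relation_span.gen by metis
next
  case (add u v)
  then show ?case using V.minus_add relation_span_closed relation_span.add by metis
qed

text \<open>Two preimages in \<open>F\<close> of the same element of \<open>M\<close> differ by a
  relation. This makes the inverse map in the next lemma independent of choices modulo the
  span.\<close>

lemma relation_span_tensor_diff:
  assumes "z \<in> carrier F" "w \<in> carrier F" "n \<in> carrier N"
    and "lincomb M A (\<lambda>x. x) z = lincomb M A (\<lambda>x. x) w"
  shows "vec_tensor N A z n \<oplus>\<^bsub>vec_module A N\<^esub> \<ominus>\<^bsub>vec_module A N\<^esub> vec_tensor N A w n \<in> relation_span N"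
proof -
  have "z \<ominus>\<^bsub>F\<^esub> w \<in> relations"
    using FM.mod_hom_diff[OF presentation_hom assms(1,2)] assms(4) F.minus_closed[OF assms(1,2)]
      M.r_neg[OF mod_homD(1)[OF presentation_hom assms(2)]]
    unfolding relations_def by (simp add: a_minus_def[of M])
  then have "vec_tensor N A (z \<ominus>\<^bsub>F\<^esub> w) n \<in> relation_span N" using assms(3) by (rule relation_span.gen)
  then show ?thesis
    using vec_tensor_add_left[OF assms(1) F.a_inv_closed[OF assms(2)] assms(3)] vec_tensor_uminus_left[OF assms(2,3)]
    unfolding a_minus_def by simp
qed

text \<open>Right exactness: the kernel of the map from N^A to M tensor N comes from K tensor N. The
  inverse map from M tensor N to N^A modulo the span is built on the free abelian group by choosing
  preimages \<open>s m\<close>; the quotient itself is never formed, and all identities are read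
  modulo \<open>relation_span N\<close>.\<close>

lemma tensor_rel_imp_relation_span:
  assumes z: "z \<in> carrier (vec_module A N)" and rel: "(\<Sum>x\<in>A. frag_of (x, z x)) \<in> tensor_rel R M N"
  shows "z \<in> relation_span N"
proof -
  let ?V = "vec_module A N" and ?\<pi> = "lincomb M A (\<lambda>x. x)"
  obtain s where s: "\<And>m. m \<in> carrier M \<Longrightarrow> s m \<in> carrier F" "\<And>m. m \<in> carrier M \<Longrightarrow> ?\<pi> (s m) = m"
    using onto by metis
  note \<pi>D = mod_homD[OF presentation_hom]
  have im: "(\<lambda>(m, n). vec_tensor N A (s m) n) ` (carrier M \<times> carrier N) \<subseteq> carrier (add_monoid ?V)"
    using vec_tensor_closed s(1) by fastforce
  obtain h where h: "h \<in> hom (free_Abelian_group (carrier M \<times> carrier N)) (add_monoid ?V)"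
    and hf: "\<And>y. y \<in> carrier M \<times> carrier N \<Longrightarrow> h (frag_of y) = (\<lambda>(m, n). vec_tensor N A (s m) n) y"
    using comm_group.free_Abelian_group_universal[OF V.a_comm_group im] by blast
  let ?T = "tensor_free M N"
  have h: "h \<in> hom ?T (add_monoid ?V)" using h by (simp add: tensor_free_def)
  interpret h: group_hom ?T "add_monoid ?V" h
    using h tensor_free_group[of M N] V.a_comm_group by (simp only: group_hom_def group_hom_axioms_def comm_group_def)
  have hc: "h a \<in> carrier ?V" if "a \<in> carrier ?T" for a using h.hom_closed[OF that] by simp
  have hadd: "h (a + b) = h a \<oplus>\<^bsub>?V\<^esub> h b" if "a \<in> carrier ?T" "b \<in> carrier ?T" for a b
    using h.hom_mult[OF that] by simp
  have hinv: "h (- a) = \<ominus>\<^bsub>?V\<^esub> h a" if "a \<in> carrier ?T" for a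
  proof -
    have "inv\<^bsub>?T\<^esub> a = - a" using that unfolding tensor_free_def by simp
    then show ?thesis using h.hom_inv[OF that] by (simp add: a_inv_def)
  qed
  have hdiff: "h (a - b) = h a \<oplus>\<^bsub>?V\<^esub> \<ominus>\<^bsub>?V\<^esub> h b" if "a \<in> carrier ?T" "b \<in> carrier ?T" for a b
  proof -
    have "- b \<in> carrier ?T" using that by simp
    then show ?thesis using hadd[OF that(1)] hinv[OF that(2)] by (simp del: tensor_free_simps vec_module_simps add: diff_conv_add_uminus[of a b] del: add_uminus_conv_diff)
  qed
  have fc: "frag_of (m, n) \<in> carrier ?T" if "m \<in> carrier M" "n \<in> carrier N" for m n
    using that by (simp add: keys_frag_of)
  have dc: "a - b \<in> carrier ?T" if "a \<in> carrier ?T" "b \<in> carrier ?T" for a b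
    using that keys_diff[of a b] by auto
  have hfr: "h (frag_of (m, n)) = vec_tensor N A (s m) n" if "m \<in> carrier M" "n \<in> carrier N" for m n
    using hf[of "(m, n)"] that by simp
  have grp: "a \<oplus>\<^bsub>?V\<^esub> \<ominus>\<^bsub>?V\<^esub> b \<oplus>\<^bsub>?V\<^esub> \<ominus>\<^bsub>?V\<^esub> c = a \<oplus>\<^bsub>?V\<^esub> \<ominus>\<^bsub>?V\<^esub> (b \<oplus>\<^bsub>?V\<^esub> c)"
    if "a \<in> carrier ?V" "b \<in> carrier ?V" "c \<in> carrier ?V" for a b c
    using that V.minus_add V.a_assoc V.a_inv_closed by metis
  \<comment> \<open>Additivity in \<open>N\<close> is respected exactly. The other two kinds of
    generators compare \<open>s\<close> of a sum or multiple with the sum or multiple of values of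
    \<open>s\<close>, which are preimages of the same element.\<close>
  have gens: "h c \<in> relation_span N" if "c \<in>
      {frag_of (x \<oplus>\<^bsub>M\<^esub> x', y) - frag_of (x, y) - frag_of (x', y) | x x' y.
         x \<in> carrier M \<and> x' \<in> carrier M \<and> y \<in> carrier N} \<union>
      {frag_of (x, y \<oplus>\<^bsub>N\<^esub> y') - frag_of (x, y) - frag_of (x, y') | x y y'.
         x \<in> carrier M \<and> y \<in> carrier N \<and> y' \<in> carrier N} \<union>
      {frag_of (r \<odot>\<^bsub>M\<^esub> x, y) - frag_of (x, r \<odot>\<^bsub>N\<^esub> y) | r x y.
         r \<in> carrier R \<and> x \<in> carrier M \<and> y \<in> carrier N}" for c
    using that
  proof (elim UnE CollectE exE conjE)
    fix x x' y assume c: "c = frag_of (x \<oplus>\<^bsub>M\<^esub> x', y) - frag_of (x, y) - frag_of (x', y)"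
      and xy: "x \<in> carrier M" "x' \<in> carrier M" "y \<in> carrier N"
    have xx: "x \<oplus>\<^bsub>M\<^esub> x' \<in> carrier M" using xy by simp
    have "h c = vec_tensor N A (s (x \<oplus>\<^bsub>M\<^esub> x')) y \<oplus>\<^bsub>?V\<^esub> \<ominus>\<^bsub>?V\<^esub> vec_tensor N A (s x \<oplus>\<^bsub>F\<^esub> s x') y"
      using hdiff[OF dc fc] hdiff[OF fc fc] xy xx fc dc s(1) vec_tensor_closed
      by (simp only: c hfr grp vec_tensor_add_left)
    moreover have "\<dots> \<in> relation_span N"
      using xy xx s \<pi>D(2) F.a_closed[OF s(1)[OF xy(1)] s(1)[OF xy(2)]] by (intro relation_span_tensor_diff) (simp_all only:)
    ultimately show ?thesis by (simp only:)
  next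
    fix x y y' assume c: "c = frag_of (x, y \<oplus>\<^bsub>N\<^esub> y') - frag_of (x, y) - frag_of (x, y')"
      and xy: "x \<in> carrier M" "y \<in> carrier N" "y' \<in> carrier N"
    have yy: "y \<oplus>\<^bsub>N\<^esub> y' \<in> carrier N" using xy by simp
    have "h c = vec_tensor N A (s x) (y \<oplus>\<^bsub>N\<^esub> y') \<oplus>\<^bsub>?V\<^esub> \<ominus>\<^bsub>?V\<^esub> vec_tensor N A (s x) (y \<oplus>\<^bsub>N\<^esub> y')"
      using hdiff[OF dc fc] hdiff[OF fc fc] xy yy fc dc s(1) vec_tensor_closed
      by (simp only: c hfr grp vec_tensor_add_right V.a_closed)
    moreover have "\<dots> = \<zero>\<^bsub>?V\<^esub>" by (rule V.r_neg) (intro vec_tensor_closed s xy yy)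
    ultimately show ?thesis using relation_span.zero by (simp only:)
  next
    fix r x y assume c: "c = frag_of (r \<odot>\<^bsub>M\<^esub> x, y) - frag_of (x, r \<odot>\<^bsub>N\<^esub> y)"
      and xy: "r \<in> carrier R" "x \<in> carrier M" "y \<in> carrier N"
    have rr: "r \<odot>\<^bsub>M\<^esub> x \<in> carrier M" "r \<odot>\<^bsub>N\<^esub> y \<in> carrier N" using xy by simp_all
    have "h c = vec_tensor N A (s (r \<odot>\<^bsub>M\<^esub> x)) y \<oplus>\<^bsub>?V\<^esub> \<ominus>\<^bsub>?V\<^esub> vec_tensor N A (r \<odot>\<^bsub>F\<^esub> s x) y"
      using hdiff[OF fc fc] xy rr s(1) by (simp only: c hfr vec_tensor_smult)
    moreover have "\<dots> \<in> relation_span N"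
      using xy rr s \<pi>D(3) F.smult_closed[OF xy(1) s(1)[OF xy(2)]] by (intro relation_span_tensor_diff) (simp_all only:)
    ultimately show ?thesis by (simp only:)
  qed
  have hrel: "h c \<in> relation_span N" if "c \<in> tensor_rel R M N" for c
    using that unfolding tensor_rel_def
  proof (induction rule: generate.induct)
    case one
    have "h 0 = \<zero>\<^bsub>?V\<^esub>" using h.hom_one by simp
    then show ?case using relation_span.zero by (simp only: tensor_free_simps)
  next
    case (incl c) then show ?case by (rule gens)
  next
    case (inv c)
    have cc: "c \<in> carrier ?T" using subsetD[OF tensor_free_gens[OF module_axioms N] inv] .
    then have "inv\<^bsub>?T\<^esub> c = - c" unfolding tensor_free_def by simp
    then show ?case using hinv[OF cc] relation_span_uminus[OF gens[OF inv]] by (simp only:)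
  next
    case (eng a b)
    have "generate ?T
     ({frag_of (x \<oplus>\<^bsub>M\<^esub> x', y) - frag_of (x, y) - frag_of (x', y) | x x' y.
         x \<in> carrier M \<and> x' \<in> carrier M \<and> y \<in> carrier N} \<union>
      {frag_of (x, y \<oplus>\<^bsub>N\<^esub> y') - frag_of (x, y) - frag_of (x, y') | x y y'.
         x \<in> carrier M \<and> y \<in> carrier N \<and> y' \<in> carrier N} \<union>
      {frag_of (r \<odot>\<^bsub>M\<^esub> x, y) - frag_of (x, r \<odot>\<^bsub>N\<^esub> y) | r x y.
         r \<in> carrier R \<and> x \<in> carrier M \<and> y \<in> carrier N}) \<subseteq> carrier ?T"
      using subgroup.subset[OF tensor_rel_subgroup[OF module_axioms N]] unfolding tensor_rel_def .
    then have "a \<in> carrier ?T" "b \<in> carrier ?T" using eng(1,2) by (blast)+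
    then show ?case using hadd relation_span.add[OF eng(3,4)] by (simp only: tensor_free_simps)
  qed
  have zc: "z x \<in> carrier N" if "x \<in> A" for x using z that by auto
  have xM: "x \<in> carrier M" if "x \<in> A" for x using sub that by blast
  have tc: "(\<Sum>x\<in>I. frag_of (x, z x)) \<in> carrier ?T" if "I \<subseteq> A" for I
    using finite_subset[OF that fin] that
  proof (induction I rule: finite_induct)
    case (insert x I)
    have "frag_of (x, z x) + (\<Sum>x\<in>I. frag_of (x, z x)) \<in> carrier ?T"
      using h.G.m_closed[OF fc[OF xM zc] insert.IH, of x x] insert.prems by simp
    then show ?case by (simp only: sum.insert[OF insert.hyps])
  qed simp
  \<comment> \<open>Going from N^A to the free abelian group and back by \<open>h\<close> is the
    identity modulo the span, because the unit vector at \<open>x\<close> and \<open>s x\<close>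
    both map to \<open>x\<close>. The induction runs over truncations of \<open>z\<close> to subsets
    of \<open>A\<close>.\<close>
  have part: "(\<lambda>y\<in>A. if y \<in> I then z y else \<zero>\<^bsub>N\<^esub>) \<oplus>\<^bsub>?V\<^esub> \<ominus>\<^bsub>?V\<^esub> h (\<Sum>x\<in>I. frag_of (x, z x)) \<in> relation_span N"
    if "I \<subseteq> A" for I
    using finite_subset[OF that fin] that
  proof (induction I rule: finite_induct)
    case empty
    have "h 0 = \<zero>\<^bsub>?V\<^esub>" using h.hom_one by simp
    then have "(\<lambda>y\<in>A. if y \<in> {} then z y else \<zero>\<^bsub>N\<^esub>) \<oplus>\<^bsub>?V\<^esub> \<ominus>\<^bsub>?V\<^esub> h (\<Sum>x\<in>{}. frag_of (x, z x)) = \<zero>\<^bsub>?V\<^esub>"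
      using V.r_neg[OF V.zero_closed] by simp
    then show ?case using relation_span.zero by (simp only:)
  next
    case (insert x I)
    let ?u = "\<lambda>I. (\<lambda>y\<in>A. if y \<in> I then z y else \<zero>\<^bsub>N\<^esub>)" and ?c = "\<lambda>I. \<Sum>x\<in>I. frag_of (x, z x)"
    let ?e = "vec_tensor N A (unit_vec R A x) (z x)" and ?t = "vec_tensor N A (s x) (z x)"
    have x: "x \<in> A" and IA: "I \<subseteq> A" using insert.prems by auto
    have uc: "?u J \<in> carrier ?V" for J using zc by auto
    have e: "?u (insert x I) = ?e \<oplus>\<^bsub>?V\<^esub> ?u I"
      using insert.hyps zc x by (auto simp: fun_eq_iff vec_tensor_def unit_vec_def)
    have "h (?c (insert x I)) = h (frag_of (x, z x)) \<oplus>\<^bsub>?V\<^esub> h (?c I)"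
      using hadd[OF fc[OF xM[OF x] zc[OF x]] tc[OF IA]] by (simp only: sum.insert[OF insert.hyps])
    also have "h (frag_of (x, z x)) = ?t" using hfr[OF xM[OF x] zc[OF x]] .
    finally have hc': "h (?c (insert x I)) = ?t \<oplus>\<^bsub>?V\<^esub> h (?c I)" .
    have "?\<pi> (unit_vec R A x) = ?\<pi> (s x)"
      using s(2)[OF xM[OF x]] lincomb_unit_vec[OF fin _ x, of "\<lambda>x. x"] sub by auto
    then have te: "?e \<oplus>\<^bsub>?V\<^esub> \<ominus>\<^bsub>?V\<^esub> ?t \<in> relation_span N"
      by (intro relation_span_tensor_diff unit_vec_F s(1) xM zc x)
    have cl: "?e \<in> carrier ?V" "?t \<in> carrier ?V" "h (?c I) \<in> carrier ?V"
      by (intro vec_tensor_closed unit_vec_F s(1) xM zc x hc tc[OF IA])+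
    have "?e \<oplus>\<^bsub>?V\<^esub> ?u I \<oplus>\<^bsub>?V\<^esub> \<ominus>\<^bsub>?V\<^esub> (?t \<oplus>\<^bsub>?V\<^esub> h (?c I)) =
        (?e \<oplus>\<^bsub>?V\<^esub> \<ominus>\<^bsub>?V\<^esub> ?t) \<oplus>\<^bsub>?V\<^esub> (?u I \<oplus>\<^bsub>?V\<^esub> \<ominus>\<^bsub>?V\<^esub> h (?c I))"
      using cl uc[of I] by (simp only: V.minus_add V.a_ac V.a_inv_closed V.a_closed)
    then show ?case using relation_span.add[OF te insert.IH[OF IA]] by (simp only: e hc')
  qed
  have "(\<lambda>y\<in>A. if y \<in> A then z y else \<zero>\<^bsub>N\<^esub>) = z" using z by (auto simp: fun_eq_iff PiE_iff extensional_def)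
  then have "z \<oplus>\<^bsub>?V\<^esub> \<ominus>\<^bsub>?V\<^esub> h (\<Sum>x\<in>A. frag_of (x, z x)) \<in> relation_span N" using part[of A] by (simp only: subset_refl)
  \<comment> \<open>\<open>z\<close> is the sum of its defect \<open>z - h(...)\<close> and of
    \<open>h(...)\<close>; the latter is in the span since the formal sum is a tensor
    relation.\<close>
  from relation_span.add[OF this hrel[OF rel]]
  show ?thesis
    using z hc[OF tc[OF subset_refl]] V.a_assoc V.l_neg V.r_zero V.a_inv_closed by (simp only:)
qed

end

end

section \<open>Formal sums that vanish in a tensor product\<close>

lemma tensor_rel_sum:
  assumes "module R M" "module R N" "\<And>i. i \<in> I \<Longrightarrow> c i \<in> tensor_rel R M N"
  shows "(\<Sum>i\<in>I. c i) \<in> tensor_rel R M N"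
  using assms(3) by (induction I rule: infinite_finite_induct) (auto intro: tensor_rel_closed[OF assms(1,2)])

lemma tensor_rel_finsum_left:
  assumes M: "module R M" and N: "module R N" and "finite I" "u \<in> I \<rightarrow> carrier M" "n \<in> carrier N"
  shows "(\<Sum>i\<in>I. frag_of (u i, n)) - frag_of (\<Oplus>\<^bsub>M\<^esub>i\<in>I. u i, n) \<in> tensor_rel R M N"
proof -
  interpret M: module R M by (rule M)
  note rel = tensor_rel_closed[OF M N]
  show ?thesis using assms(3,4)
  proof (induction I rule: finite_induct)
    case empty
    \<comment> \<open>Additivity for zero plus zero simplifies to minus the symbol of (0,
      \<open>n\<close>), which is the claim for the empty sum.\<close>
    then show ?case using tensor_rel_gens(1)[of "\<zero>\<^bsub>M\<^esub>" M "\<zero>\<^bsub>M\<^esub>" n N R] assms(5) by simp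
  next
    case (insert i I)
    then have c: "u i \<in> carrier M" "u \<in> I \<rightarrow> carrier M" "(\<Oplus>\<^bsub>M\<^esub>i\<in>I. u i) \<in> carrier M" by (auto intro: M.finsum_closed)
    have "frag_of (\<Oplus>\<^bsub>M\<^esub>i\<in>insert i I. u i, n) - frag_of (u i, n) - frag_of (\<Oplus>\<^bsub>M\<^esub>i\<in>I. u i, n) \<in> tensor_rel R M N"
      using tensor_rel_gens(1)[OF c(1,3) assms(5)] insert.hyps c by simp
    from rel(4)[OF insert.IH[OF c(2)] this] show ?case using insert.hyps by (simp add: algebra_simps)
  qed
qed

lemma tensor_rel_lincomb:
  assumes M: "module R M" and N: "module R N" and "finite A" "A \<subseteq> carrier M" "w \<in> A \<rightarrow> carrier R" "n \<in> carrier N"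
  shows "(\<Sum>x\<in>A. frag_of (x, w x \<odot>\<^bsub>N\<^esub> n)) - frag_of (lincomb M A (\<lambda>x. x) w, n) \<in> tensor_rel R M N"
proof -
  interpret M: module R M by (rule M)
  note rel = tensor_rel_closed[OF M N]
  have "frag_of (w x \<odot>\<^bsub>M\<^esub> x, n) - frag_of (x, w x \<odot>\<^bsub>N\<^esub> n) \<in> tensor_rel R M N" if "x \<in> A" for x
    using that assms by (intro tensor_rel_gens(3)) auto
  then have 1: "(\<Sum>x\<in>A. frag_of (w x \<odot>\<^bsub>M\<^esub> x, n) - frag_of (x, w x \<odot>\<^bsub>N\<^esub> n)) \<in> tensor_rel R M N"
    by (rule tensor_rel_sum[OF M N])
  have "(\<lambda>x. w x \<odot>\<^bsub>M\<^esub> x) \<in> A \<rightarrow> carrier M" using assms by auto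
  from tensor_rel_finsum_left[OF M N assms(3) this assms(6)]
  have "(\<Sum>x\<in>A. frag_of (w x \<odot>\<^bsub>M\<^esub> x, n)) - frag_of (lincomb M A (\<lambda>x. x) w, n) \<in> tensor_rel R M N"
    unfolding lincomb_def .
  from rel(4)[OF this 1] show ?thesis by (simp add: sum_subtractf)
qed

context presentation
begin

lemma tensor_rel_relation:
  assumes N: "module R N" and w: "w \<in> relations" and n: "n \<in> carrier N"
  shows "(\<Sum>x\<in>A. frag_of (x, w x \<odot>\<^bsub>N\<^esub> n)) \<in> tensor_rel R M N"
proof -
  note rel = tensor_rel_closed[OF module_axioms N]
  have "w \<in> A \<rightarrow> carrier R" using relations_closed[OF w] by auto
  from tensor_rel_lincomb[OF module_axioms N fin sub this n]
  have "(\<Sum>x\<in>A. frag_of (x, w x \<odot>\<^bsub>N\<^esub> n)) - frag_of (\<zero>\<^bsub>M\<^esub>, n) \<in> tensor_rel R M N"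
    using w by (simp add: relations_def)
  moreover have "- frag_of (\<zero>\<^bsub>M\<^esub>, n) \<in> tensor_rel R M N"
    using tensor_rel_finsum_left[OF module_axioms N, of "{}" "\<lambda>x. x" n] n by simp
  ultimately show ?thesis using rel(4) by fastforce
qed

lemma frag_sum_closed:
  "z \<in> A \<rightarrow> carrier N \<Longrightarrow> (\<Sum>x\<in>A. frag_of (x, z x)) \<in> carrier (tensor_free M N)"
  using sub keys_sum[of "\<lambda>x. frag_of (x, z x)" A] by (fastforce simp: keys_frag_of)

text \<open>A relation \<open>w\<close> says that the sum of the x tensor \<open>w x\<close>
  vanishes in M tensor R. Flatness, applied to the ideal generated by the coordinates of
  \<open>w\<close>, makes it vanish already over that ideal, and right exactness writes
  \<open>w\<close> as a sum of terms \<open>n k\<close> with \<open>k\<close> a relation and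
  \<open>n\<close> in the ideal. Expanding each \<open>n\<close> in the coordinates of
  \<open>w\<close> turns this sum into the value at \<open>w\<close> of an endomorphism.\<close>

lemma relation_fixed_if_flat:
  assumes flat: "flat_module TYPE('a) TYPE('a) R M" and w: "w \<in> relations"
  shows "\<exists>C\<in>rel_endos. C w = w"
proof -
  let ?R = "restrict_scalars R (\<lambda>x. x)"
  have Rm: "module R ?R" by (rule ring_module_module) unfold_locales
  interpret Rm: module R ?R by (rule Rm)
  interpret FR: module_pair R F ?R unfolding module_pair_def using F.module_axioms Rm by blast
  have wA: "w \<in> A \<rightarrow> carrier R" and wF: "w \<in> carrier F" using relations_closed[OF w] by auto
  let ?l = "lincomb ?R A w"
  have l: "?l \<in> mod_hom R F ?R" using fin wA by (intro Rm.lincomb_hom) auto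
  \<comment> \<open>The ideal generated by the coordinates of \<open>w\<close>, as the image of the
    linear form that pairs vectors with \<open>w\<close>; each element thus comes with its
    coefficients.\<close>
  define I where "I = ?l ` carrier F"
  have I: "submodule I R ?R" unfolding I_def by (rule FR.mod_hom_image_submodule[OF l])
  have Ic: "I \<subseteq> carrier R" using Rm.submoduleE(1)[OF I] by simp
  define N where "N = ?R\<lparr>carrier := I\<rparr>"
  have N: "module R N" unfolding N_def by (rule submodule.submodule_is_module[OF I Rm])
  have Nsimps: "carrier N = I" "\<zero>\<^bsub>N\<^esub> = \<zero>" "\<And>x y. x \<oplus>\<^bsub>N\<^esub> y = x \<oplus> y" "\<And>r x. r \<odot>\<^bsub>N\<^esub> x = r \<otimes> x"
    by (simp_all add: N_def restrict_scalars_def)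
  have wI: "w x \<in> I" if "x \<in> A" for x
    unfolding I_def using Rm.lincomb_unit_vec[OF fin _ that, of w] wA unit_vec_F
    by (intro image_eqI[of _ _ "unit_vec R A x"]) auto
  let ?c = "\<Sum>x\<in>A. frag_of (x, w x)"
  have i: "(\<lambda>x. x) \<in> mod_hom R N ?R" using Ic by (auto simp: mod_hom_def Nsimps)
  have idM: "(\<lambda>x. x) \<in> mod_hom R M M" by (auto simp: mod_hom_def)
  have inj: "inj_on (tensor_map R M ?R (\<lambda>x. x) (\<lambda>x. x)) (carrier (tensor_group R M N))"
    using flat N Rm i unfolding flat_module_def by (auto simp: inj_on_def)
  have carr: "tensor_rel R M N #>\<^bsub>tensor_free M N\<^esub> a \<in> carrier (tensor_group R M N)"
    if "a \<in> carrier (tensor_free M N)" for a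
    using that unfolding tensor_group_def carrier_FactGroup by blast
  have c: "?c \<in> carrier (tensor_free M N)" using wI by (intro frag_sum_closed) (auto simp: Nsimps)
  have push: "tensor_push (\<lambda>x. x) (\<lambda>x. x) a = a" for a :: "'c \<times> 'a \<Rightarrow>\<^sub>0 int"
    by (rule frag_diff_induct[of a UNIV]) auto
  have eq: "tensor_rel R M ?R #>\<^bsub>tensor_free M ?R\<^esub> ?c = tensor_rel R M ?R #>\<^bsub>tensor_free M ?R\<^esub> 0"
  proof (rule tensor_coset_eq[OF module_axioms Rm])
    have "(\<Sum>x\<in>A. frag_of (x, w x \<otimes> \<one>)) = ?c" using wA by (intro sum.cong) (auto simp: Pi_iff)
    then show "?c - 0 \<in> tensor_rel R M ?R" using tensor_rel_relation[OF Rm w, of \<one>] by simp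
  qed
  have "0 \<in> carrier (tensor_free M N)" by simp
  then have "tensor_rel R M N #>\<^bsub>tensor_free M N\<^esub> ?c = tensor_rel R M N #>\<^bsub>tensor_free M N\<^esub> 0"
    using eq by (intro inj_onD[OF inj _ carr[OF c] carr])
      (simp_all only: tensor_map_coset[OF module_axioms N module_axioms Rm idM i] push)
  moreover have "?c \<in> tensor_rel R M N #>\<^bsub>tensor_free M N\<^esub> ?c"
    using tensor_rel_closed(1)[OF module_axioms N] by (simp add: tensor_coset)
  ultimately have "?c \<in> tensor_rel R M N" by (simp add: tensor_coset)
  moreover have "w \<in> carrier (vec_module A N)" using wF wI by (auto simp: Nsimps PiE_iff)
  ultimately have "w \<in> relation_span N" by (intro tensor_rel_imp_relation_span[OF N])
  moreover have "\<exists>C\<in>rel_endos. C w = v" if "v \<in> relation_span N" for v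
    using that
  proof (induction rule: relation_span.induct)
    case zero
    have "(\<lambda>z. \<zero>\<^bsub>F\<^esub>) \<in> mod_hom R F F" by (intro mod_homI) (auto simp del: vec_module_simps)
    moreover have "\<zero>\<^bsub>F\<^esub> \<in> relations"
      using F.r_neg[OF wF] relations_minus[OF w w] unfolding a_minus_def by metis
    ultimately have Z: "(\<lambda>z. \<zero>\<^bsub>F\<^esub>) \<in> rel_endos" unfolding rel_endos_def by blast
    have "\<zero>\<^bsub>F\<^esub> = \<zero>\<^bsub>vec_module A N\<^esub>" by (simp add: Nsimps)
    then show ?case by (rule bexI[OF _ Z])
  next
    case (gen k n)
    then obtain a where a: "a \<in> carrier F" "n = ?l a" unfolding Nsimps I_def by blast
    have aA: "a \<in> A \<rightarrow> carrier ?R" using a(1) by auto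
    have la: "lincomb ?R A a \<in> mod_hom R F ?R" using fin aA by (rule Rm.lincomb_hom)
    have kF: "k \<in> carrier F" using gen(1) by (rule relations_closed)
    \<comment> \<open>With \<open>n\<close> the pairing of \<open>a\<close> and \<open>w\<close>,
      the rank one map that pairs \<open>z\<close> with \<open>a\<close> and multiplies
      \<open>k\<close> by the result takes \<open>w\<close> to \<open>n k\<close>.\<close>
    let ?C = "\<lambda>z. lincomb ?R A a z \<odot>\<^bsub>F\<^esub> k"
    have lc: "lincomb ?R A a z \<in> carrier R" if "z \<in> carrier F" for z using mod_homD(1)[OF la that] by simp
    have "?C \<in> mod_hom R F F"
    proof (rule mod_homI)
      show "?C z \<in> carrier F" if "z \<in> carrier F" for z using F.smult_closed[OF lc[OF that] kF] .
      show "?C (z \<oplus>\<^bsub>F\<^esub> z') = ?C z \<oplus>\<^bsub>F\<^esub> ?C z'" if "z \<in> carrier F" "z' \<in> carrier F" for z z'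
        using mod_homD(2)[OF la that] F.smult_l_distr[OF lc[OF that(1)] lc[OF that(2)] kF] by simp
      show "?C (r \<odot>\<^bsub>F\<^esub> z) = r \<odot>\<^bsub>F\<^esub> ?C z" if "r \<in> carrier R" "z \<in> carrier F" for r z
        using mod_homD(3)[OF la that] F.smult_assoc1[OF that(1) lc[OF that(2)] kF] by simp
    qed
    moreover have "?C z \<in> relations" if "z \<in> carrier F" for z
      using relations_smult[OF lc[OF that] gen(1)] .
    ultimately have C: "?C \<in> rel_endos" unfolding rel_endos_def by blast
    have "lincomb ?R A a w = n"
      unfolding a(2) lincomb_def using wA aA by (simp add: Pi_iff) (intro R.finsum_cong', auto simp: R.m_comm)
    then have "?C w = vec_tensor N A k n"
      using kF lc[OF wF] by (auto simp: vec_tensor_def Nsimps fun_eq_iff R.m_comm PiE_iff)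
    then show ?case by (rule bexI[OF _ C])
  next
    case (add u v)
    then obtain C D where CD: "C \<in> rel_endos" "C w = u" "D \<in> rel_endos" "D w = v" by blast
    have "C w \<oplus>\<^bsub>F\<^esub> D w = u \<oplus>\<^bsub>vec_module A N\<^esub> v" by (simp add: CD Nsimps)
    then show ?case by (rule bexI[OF _ rel_endos_add[OF CD(1,3)]])
  qed
  ultimately show ?thesis by blast
qed

end

section \<open>Base change\<close>

text \<open>\<open>projective_module\<close> only tests free modules on subsets of \<open>T\<close> here, so the section is first
  built over the index set \<open>e ` A\<close> and then transported to \<open>A\<close>.\<close>

lemma projective_module_section:
  fixes S :: "('s, 'b) ring_scheme" and T :: "('s, 't) module" and A :: "'i set"
  assumes proj: "projective_module TYPE('t \<Rightarrow> 's) TYPE('t) S T"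
    and fin: "finite A" and e: "e \<in> A \<rightarrow> carrier T"
    and onto: "carrier T \<subseteq> lincomb T A e ` carrier (free_module S A)"
  shows "\<exists>h\<in>mod_hom S T (free_module S A). \<forall>y\<in>carrier T. lincomb T A e (h y) = y"
proof -
  have T: "module S T" using proj by (simp add: projective_module_def)
  interpret T: module S T by (rule T)
  let ?A' = "e ` A"
  have FS: "module S (free_module S A)" "module S (free_module S ?A')"
    by (rule free_module_module[OF T.R.is_cring])+
  interpret FA: module S "free_module S A" by (rule FS)
  interpret FA': module S "free_module S ?A'" by (rule FS)
  have fin': "finite ?A'" and sub': "?A' \<subseteq> carrier T" using fin e by auto
  let ?g = "lincomb T ?A' (\<lambda>t. t)"
  have g: "?g \<in> mod_hom S (free_module S ?A') T" using fin' sub' by (intro T.lincomb_hom) auto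
  have \<kappa>: "lincomb T A e \<in> mod_hom S (free_module S A) T" by (rule T.lincomb_hom[OF fin e])
  let ?u = "\<lambda>x. unit_vec S ?A' (e x)" and ?v = "\<lambda>t. unit_vec S A (inv_into A e t)"
  have u: "?u \<in> A \<rightarrow> carrier (free_module S ?A')" and v: "?v \<in> ?A' \<rightarrow> carrier (free_module S A)"
    by (simp_all add: Pi_iff T.R.is_cring)
  have up: "lincomb (free_module S ?A') A ?u \<in> mod_hom S (free_module S A) (free_module S ?A')"
    by (rule FA'.lincomb_hom[OF fin u])
  have down: "lincomb (free_module S A) ?A' ?v \<in> mod_hom S (free_module S ?A') (free_module S A)"
    by (rule FA.lincomb_hom[OF fin' v])
  have sub'': "(\<lambda>t. t) \<in> ?A' \<rightarrow> carrier T" using sub' by auto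
  have gup: "?g (lincomb (free_module S ?A') A ?u z) = lincomb T A e z" if "z \<in> carrier (free_module S A)" for z
  proof (rule T.mod_hom_free_module_cong[OF fin mod_hom_comp[OF up g] \<kappa>])
    show "?g (lincomb (free_module S ?A') A ?u (unit_vec S A x)) = lincomb T A e (unit_vec S A x)" if "x \<in> A" for x
      using that T.lincomb_unit_vec[OF fin e that] FA'.lincomb_unit_vec[OF fin u that]
        T.lincomb_unit_vec[OF fin' sub'', of "e x"] by simp
  qed (use that in simp)
  have \<kappa>down: "lincomb T A e (lincomb (free_module S A) ?A' ?v z) = ?g z" if "z \<in> carrier (free_module S ?A')" for z
  proof (rule T.mod_hom_free_module_cong[OF fin' mod_hom_comp[OF down \<kappa>] g])
    show "lincomb T A e (lincomb (free_module S A) ?A' ?v (unit_vec S ?A' t)) = ?g (unit_vec S ?A' t)" if t: "t \<in> ?A'" for t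
      using T.lincomb_unit_vec[OF fin e inv_into_into[OF t]] FA.lincomb_unit_vec[OF fin' v t]
        T.lincomb_unit_vec[OF fin' sub'' t] f_inv_into_f[OF t] by simp
  qed (use that in simp)
  have "?g ` carrier (free_module S ?A') = carrier T"
  proof
    show "?g ` carrier (free_module S ?A') \<subseteq> carrier T" using mod_homD(1)[OF g] by blast
    show "carrier T \<subseteq> ?g ` carrier (free_module S ?A')"
    proof
      fix y assume "y \<in> carrier T"
      then obtain z where z: "z \<in> carrier (free_module S A)" "y = lincomb T A e z" using onto by blast
      then show "y \<in> ?g ` carrier (free_module S ?A')"
        using gup[OF z(1)] mod_homD(1)[OF up z(1)] by (metis image_eqI)
    qed
  qed
  moreover have "(\<lambda>y. y) \<in> mod_hom S T T" by (auto simp: mod_hom_def)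
  ultimately obtain h where h: "h \<in> mod_hom S T (free_module S ?A')" "\<And>y. y \<in> carrier T \<Longrightarrow> ?g (h y) = y"
    using proj FS(2) T g unfolding projective_module_def by blast
  show ?thesis
  proof (intro bexI ballI)
    show "(\<lambda>y. lincomb (free_module S A) ?A' ?v (h y)) \<in> mod_hom S T (free_module S A)"
      by (rule mod_hom_comp[OF h(1) down])
    show "lincomb T A e (lincomb (free_module S A) ?A' ?v (h y)) = y" if "y \<in> carrier T" for y
      using \<kappa>down[OF mod_homD(1)[OF h(1) that]] h(2)[OF that] by simp
  qed
qed

section \<open>The presentation of the base change by \<open>S^A\<close>\<close>

locale base_change_presentation = pure_presentation +
  fixes S :: "('s, 'k) ring_scheme" and \<phi> :: "'a \<Rightarrow> 's"
  assumes S_cring: "cring S" and \<phi>_hom: "\<phi> \<in> ring_hom R S"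
begin

sublocale \<phi>: ring_hom_cring R S \<phi>
  using S_cring \<phi>_hom R.is_cring by (simp add: ring_hom_cring_def ring_hom_cring_axioms_def)

abbreviation S_mod where "S_mod \<equiv> restrict_scalars S \<phi>"
abbreviation T where "T \<equiv> base_change R S \<phi> M"
abbreviation FS where "FS \<equiv> free_module S A"

definition tensor_class where
  "tensor_class c = tensor_rel R M S_mod #>\<^bsub>tensor_free M S_mod\<^esub> c"

definition base_gen where "base_gen x = tensor_class (frag_of (x, \<one>\<^bsub>S\<^esub>))"

lemma S_mod_module: "module R S_mod"
  by (rule restrict_scalars_module[OF R.is_cring S_cring \<phi>_hom])

sublocale T: module S T
  by (rule base_change_module[OF R.is_cring S_cring \<phi>_hom module_axioms])

sublocale FS: module S FS
  by (rule free_module_module[OF S_cring])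

sublocale FST: module_pair S FS T
  unfolding module_pair_def using FS.module_axioms T.module_axioms by blast

sublocale TFS: module_pair S T FS
  unfolding module_pair_def using FS.module_axioms T.module_axioms by blast

sublocale FSFS: module_pair S FS FS
  unfolding module_pair_def using FS.module_axioms by blast

lemma mem_tensor_class: "c \<in> tensor_class c"
  using tensor_rel_closed(1)[OF module_axioms S_mod_module] by (simp add: tensor_class_def tensor_coset)

lemma tensor_class_eqI: "a - b \<in> tensor_rel R M S_mod \<Longrightarrow> tensor_class a = tensor_class b"
  unfolding tensor_class_def by (rule tensor_coset_eq[OF module_axioms S_mod_module])

lemma tensor_class_zero: "tensor_class 0 = \<zero>\<^bsub>T\<^esub>"
  by (simp add: tensor_class_def tensor_coset base_change_def Let_def tensor_group_def)

lemma tensor_class_eq_zeroD: "tensor_class c = \<zero>\<^bsub>T\<^esub> \<Longrightarrow> c \<in> tensor_rel R M S_mod"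
  using mem_tensor_class[of c] by (simp add: base_change_def Let_def tensor_group_def)

lemma carrier_base_change: "carrier T = tensor_class ` carrier (tensor_free M S_mod)"
  by (simp add: base_change_def Let_def tensor_group_def carrier_FactGroup tensor_class_def)

lemma tensor_class_add:
  assumes "a \<in> carrier (tensor_free M S_mod)" "b \<in> carrier (tensor_free M S_mod)"
  shows "tensor_class (a + b) = tensor_class a \<oplus>\<^bsub>T\<^esub> tensor_class b"
proof -
  interpret G: comm_group "tensor_free M S_mod" by (rule tensor_free_group)
  interpret K: normal "tensor_rel R M S_mod" "tensor_free M S_mod"
    using G.normal_iff_subgroup tensor_rel_subgroup[OF module_axioms S_mod_module] by simp
  show ?thesis using K.rcos_sum[OF assms]
    by (simp add: base_change_def Let_def tensor_group_def tensor_class_def)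
qed

lemma tensor_class_smult:
  assumes "s \<in> carrier S"
  shows "s \<odot>\<^bsub>T\<^esub> tensor_class c = tensor_class (tensor_push (\<lambda>x. x) (\<lambda>t. s \<otimes>\<^bsub>S\<^esub> t) c)"
proof -
  have "(\<lambda>x. x) \<in> mod_hom R M M" "(\<lambda>t. s \<otimes>\<^bsub>S\<^esub> t) \<in> mod_hom R S_mod S_mod"
    using assms by (auto simp: mod_hom_def \<phi>.S.r_distr \<phi>.S.m_lcomm)
  from tensor_map_coset[OF module_axioms S_mod_module module_axioms S_mod_module this]
  show ?thesis by (simp add: base_change_def Let_def tensor_group_def tensor_class_def)
qed

lemma frag_closed: "x \<in> carrier M \<Longrightarrow> s \<in> carrier S \<Longrightarrow> frag_of (x, s) \<in> carrier (tensor_free M S_mod)"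
  by (simp add: keys_frag_of)

lemma base_gen_closed: "base_gen \<in> A \<rightarrow> carrier T"
proof
  fix x assume "x \<in> A"
  then have "frag_of (x, \<one>\<^bsub>S\<^esub>) \<in> carrier (tensor_free M S_mod)" using sub by (intro frag_closed) auto
  then show "base_gen x \<in> carrier T" unfolding base_gen_def carrier_base_change by blast
qed

lemma lincomb_base_gen:
  assumes "z \<in> carrier FS"
  shows "lincomb T A base_gen z = tensor_class (\<Sum>x\<in>A. frag_of (x, z x))"
proof -
  \<comment> \<open>Membership in the free abelian group is carried along because additivity of
    \<open>tensor_class\<close> is only available for its elements.\<close>
  have "(\<Oplus>\<^bsub>T\<^esub>x\<in>I. z x \<odot>\<^bsub>T\<^esub> base_gen x) = tensor_class (\<Sum>x\<in>I. frag_of (x, z x)) \<and>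
      (\<Sum>x\<in>I. frag_of (x, z x)) \<in> carrier (tensor_free M S_mod)" if "I \<subseteq> A" for I
    using finite_subset[OF that fin] that
  proof (induction I rule: finite_induct)
    case empty
    then show ?case by (simp add: tensor_class_zero)
  next
    case (insert x I)
    have zc: "z y \<in> carrier S" if "y \<in> insert x I" for y using that insert.prems assms by auto
    have x: "x \<in> carrier M" using insert.prems sub by auto
    have g: "base_gen y \<in> carrier T" if "y \<in> insert x I" for y using base_gen_closed insert.prems that by auto
    have smx: "z x \<odot>\<^bsub>T\<^esub> base_gen x = tensor_class (frag_of (x, z x))"
      using zc[of x] unfolding base_gen_def by (simp add: tensor_class_smult)
    have fx: "frag_of (x, z x) \<in> carrier (tensor_free M S_mod)" by (rule frag_closed[OF x zc]) simp
    have IH: "(\<Oplus>\<^bsub>T\<^esub>x\<in>I. z x \<odot>\<^bsub>T\<^esub> base_gen x) = tensor_class (\<Sum>x\<in>I. frag_of (x, z x))"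
      "(\<Sum>x\<in>I. frag_of (x, z x)) \<in> carrier (tensor_free M S_mod)" using insert.IH insert.prems by auto
    have cl: "frag_of (x, z x) + (\<Sum>x\<in>I. frag_of (x, z x)) \<in> carrier (tensor_free M S_mod)"
      using monoid.m_closed[OF group.is_monoid[OF comm_group.axioms(2)[OF tensor_free_group]] fx IH(2)] by simp
    have "(\<Oplus>\<^bsub>T\<^esub>x\<in>insert x I. z x \<odot>\<^bsub>T\<^esub> base_gen x) = z x \<odot>\<^bsub>T\<^esub> base_gen x \<oplus>\<^bsub>T\<^esub> (\<Oplus>\<^bsub>T\<^esub>x\<in>I. z x \<odot>\<^bsub>T\<^esub> base_gen x)"
      using zc g insert.hyps by (intro T.finsum_insert) auto
    also have "\<dots> = tensor_class (frag_of (x, z x) + (\<Sum>x\<in>I. frag_of (x, z x)))"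
      unfolding smx IH(1) by (rule tensor_class_add[OF fx IH(2), symmetric])
    finally show ?case using cl by (simp only: sum.insert[OF insert.hyps] simp_thms)
  qed
  then show ?thesis unfolding lincomb_def by blast
qed

lemma lincomb_base_gen_hom: "lincomb T A base_gen \<in> mod_hom S FS T"
  by (rule T.lincomb_hom[OF fin base_gen_closed])

lemma lincomb_base_gen_onto: "carrier T \<subseteq> lincomb T A base_gen ` carrier FS"
proof
  fix y assume "y \<in> carrier T"
  then obtain c where c: "c \<in> carrier (tensor_free M S_mod)" "y = tensor_class c"
    unfolding carrier_base_change by blast
  let ?I = "lincomb T A base_gen ` carrier FS"
  have I: "submodule ?I S T" by (rule FST.mod_hom_image_submodule[OF lincomb_base_gen_hom])
  have "tensor_class c \<in> ?I \<and> c \<in> carrier (tensor_free M S_mod)" (is "?P c")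
  proof (rule frag_diff_induct[of c "carrier M \<times> carrier S" ?P])
    show "Poly_Mapping.keys c \<subseteq> carrier M \<times> carrier S" using c by simp
    have "\<zero>\<^bsub>T\<^esub> \<in> ?I"
      using FST.mod_hom_zero[OF lincomb_base_gen_hom] by (intro image_eqI[of _ _ "\<zero>\<^bsub>FS\<^esub>"]) auto
    then show "?P 0" using tensor_class_zero by simp
  next
    fix ms assume "ms \<in> carrier M \<times> carrier S"
    then obtain m s where ms: "ms = (m, s)" "m \<in> carrier M" "s \<in> carrier S" by blast
    obtain w where w: "w \<in> carrier F" "lincomb M A (\<lambda>x. x) w = m" using onto[OF ms(2)] by blast
    \<comment> \<open>If m is the combination of the generators \<open>x\<close> with coefficients
      \<open>w x\<close>, then m tensor s is the sum of the x tensor \<open>\<phi> (w x)\<close> s.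
      Classes of this kind generate all others under differences.\<close>
    let ?z = "\<lambda>x\<in>A. \<phi> (w x) \<otimes>\<^bsub>S\<^esub> s"
    have wA: "w \<in> A \<rightarrow> carrier R" using w by auto
    have z: "?z \<in> carrier FS" using wA ms(3) by (auto simp: Pi_iff)
    have "(\<Sum>x\<in>A. frag_of (x, ?z x)) = (\<Sum>x\<in>A. frag_of (x, w x \<odot>\<^bsub>S_mod\<^esub> s))" by (intro sum.cong) auto
    then have "tensor_class (\<Sum>x\<in>A. frag_of (x, ?z x)) = tensor_class (frag_of (m, s))"
      using tensor_rel_lincomb[OF module_axioms S_mod_module fin sub wA, of s] ms(3) w(2)
      by (intro tensor_class_eqI) simp
    then have "tensor_class (frag_of ms) = lincomb T A base_gen ?z"
      using lincomb_base_gen[OF z] ms(1) by simp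
    then show "?P (frag_of ms)" using z ms frag_closed by blast
  next
    fix a b assume a: "?P a" and b: "?P b"
    have ab: "a - b \<in> carrier (tensor_free M S_mod)" using a b keys_diff[of a b] by auto
    have ct: "tensor_class c \<in> carrier T" if "c \<in> carrier (tensor_free M S_mod)" for c
      unfolding carrier_base_change using that by blast
    have "tensor_class a = tensor_class (a - b) \<oplus>\<^bsub>T\<^esub> tensor_class b"
      using tensor_class_add[OF ab conjunct2[OF b]] by simp
    then have "tensor_class (a - b) = tensor_class a \<oplus>\<^bsub>T\<^esub> \<ominus>\<^bsub>T\<^esub> tensor_class b"
      using ct[OF ab] ct[OF conjunct2[OF b]] by (simp add: T.a_assoc T.r_neg)
    then show "?P (a - b)"
      using a b ab T.submoduleE(3,5)[OF I] by simp
  qed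
  then show "y \<in> ?I" using c by blast
qed

text \<open>Right exactness with \<open>S\<close> as the second factor: the kernel consists of
  combinations, with coefficients in \<open>S\<close>, of the \<open>\<phi>\<close>-images of
  relations of \<open>M\<close>.\<close>

lemma lincomb_base_gen_kernel:
  assumes z: "z \<in> carrier FS" and "lincomb T A base_gen z = \<zero>\<^bsub>T\<^esub>"
  shows "z \<in> relation_span S_mod"
proof (rule tensor_rel_imp_relation_span[OF S_mod_module])
  show "z \<in> carrier (vec_module A S_mod)" using z by simp
  show "(\<Sum>x\<in>A. frag_of (x, z x)) \<in> tensor_rel R M S_mod"
    using assms lincomb_base_gen[OF z] by (intro tensor_class_eq_zeroD) simp
qed

definition base_vec where "base_vec w = (\<lambda>x\<in>A. \<phi> (w x))"

lemma base_vec_closed: "w \<in> carrier F \<Longrightarrow> base_vec w \<in> carrier FS"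
  by (auto simp: base_vec_def)

lemma lincomb_base_gen_relation:
  assumes w: "w \<in> relations"
  shows "lincomb T A base_gen (base_vec w) = \<zero>\<^bsub>T\<^esub>"
proof -
  have wF: "w \<in> carrier F" using w by (rule relations_closed)
  have "(\<Sum>x\<in>A. frag_of (x, base_vec w x)) = (\<Sum>x\<in>A. frag_of (x, w x \<odot>\<^bsub>S_mod\<^esub> \<one>\<^bsub>S\<^esub>))"
    using wF by (intro sum.cong) (auto simp: base_vec_def PiE_iff)
  then have "tensor_class (\<Sum>x\<in>A. frag_of (x, base_vec w x)) = tensor_class 0"
    using tensor_rel_relation[OF S_mod_module w, of "\<one>\<^bsub>S\<^esub>"] by (intro tensor_class_eqI) simp
  then show ?thesis using lincomb_base_gen[OF base_vec_closed[OF wF]] tensor_class_zero by simp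
qed

text \<open>The base change of \<open>B\<close>: its matrix with \<open>\<phi>\<close> applied to
  every entry, acting on \<open>S^A\<close>.\<close>

definition base_endo where "base_endo B = lincomb FS A (\<lambda>x. base_vec (B (unit_vec R A x)))"

lemma base_endo_hom:
  assumes "B \<in> rel_endos"
  shows "base_endo B \<in> mod_hom S FS FS"
  unfolding base_endo_def using base_vec_closed[OF rel_endosD(3)[OF assms unit_vec_F]]
  by (intro FS.lincomb_hom[OF fin]) blast

lemma base_endo_base_vec:
  assumes B: "B \<in> rel_endos" and w: "w \<in> carrier F"
  shows "base_endo B (base_vec w) = base_vec (B w)"
proof -
  have Be: "B (unit_vec R A x) \<in> A \<rightarrow>\<^sub>E carrier R" for x using rel_endosD(3)[OF B unit_vec_F] by simp
  have wA: "w y \<in> carrier R" if "y \<in> A" for y using w that by auto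
  have Bey: "B (unit_vec R A x) y \<in> carrier R" if "y \<in> A" for x y using Be[of x] that by auto
  have "B w = lincomb F A (\<lambda>x. B (unit_vec R A x)) w"
    using F.mod_hom_free_module_eq[OF fin rel_endosD(1)[OF B]] w by simp
  also have "\<dots> = (\<lambda>y\<in>A. \<Oplus>x\<in>A. w x \<otimes> B (unit_vec R A x) y)"
    unfolding lincomb_def using wA Bey
    by (subst finsum_vec_module[OF ring_module_module[OF R.is_cring] fin])
      (auto intro!: restrict_ext R.finsum_cong')
  finally have Bw: "B w = (\<lambda>y\<in>A. \<Oplus>x\<in>A. w x \<otimes> B (unit_vec R A x) y)" .
  have "base_endo B (base_vec w) = (\<lambda>y\<in>A. \<Oplus>\<^bsub>S\<^esub>x\<in>A. \<phi> (w x) \<otimes>\<^bsub>S\<^esub> \<phi> (B (unit_vec R A x) y))"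
    unfolding base_endo_def lincomb_def using wA Bey
    by (subst finsum_vec_module[OF ring_module_module[OF S_cring] fin])
      (auto simp: base_vec_def intro!: restrict_ext \<phi>.S.finsum_cong')
  also have "\<dots> = base_vec (B w)"
    unfolding Bw base_vec_def
  proof (rule restrict_ext)
    fix y assume y: "y \<in> A"
    have "\<phi> (\<Oplus>x\<in>A. w x \<otimes> B (unit_vec R A x) y) = (\<Oplus>\<^bsub>S\<^esub>x\<in>A. \<phi> (w x \<otimes> B (unit_vec R A x) y))"
      using wA Bey y by (subst \<phi>.hom_finsum) (auto simp: o_def)
    also have "\<dots> = (\<Oplus>\<^bsub>S\<^esub>x\<in>A. \<phi> (w x) \<otimes>\<^bsub>S\<^esub> \<phi> (B (unit_vec R A x) y))"
      using wA Bey y by (intro \<phi>.S.finsum_cong') auto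
    finally show "(\<Oplus>\<^bsub>S\<^esub>x\<in>A. \<phi> (w x) \<otimes>\<^bsub>S\<^esub> \<phi> (B (unit_vec R A x) y)) = \<phi> ((\<lambda>y\<in>A. \<Oplus>x\<in>A. w x \<otimes> B (unit_vec R A x) y) y)"
      using y by simp
  qed
  finally show ?thesis .
qed

text \<open>An element of the span involves only finitely many relations \<open>k\<close>, each
  entering as \<open>s\<close> times \<open>base_vec k\<close>, which \<open>base_endo B\<close>
  fixes as soon as \<open>B\<close> fixes \<open>k\<close>. The set \<open>V\<close> is chosen
  before \<open>B\<close>, so several elements can share one \<open>B\<close>.\<close>

lemma relation_span_fixed:
  assumes "z \<in> relation_span S_mod"
  shows "\<exists>V. finite V \<and> V \<subseteq> relations \<and> (\<forall>B\<in>rel_endos. (\<forall>v\<in>V. B v = v) \<longrightarrow> base_endo B z = z)"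
  using assms
proof (induction rule: relation_span.induct)
  case zero
  have "\<zero>\<^bsub>vec_module A S_mod\<^esub> = \<zero>\<^bsub>FS\<^esub>" by simp
  moreover have "base_endo B \<zero>\<^bsub>FS\<^esub> = \<zero>\<^bsub>FS\<^esub>" if "B \<in> rel_endos" for B
    by (rule FSFS.mod_hom_zero[OF base_endo_hom[OF that]])
  ultimately show ?case by (intro exI[of _ "{}"]) (simp only:, blast)
next
  case (gen k s)
  have kF: "k \<in> carrier F" using gen(1) by (rule relations_closed)
  have s: "s \<in> carrier S" using gen(2) by simp
  have kA: "k y \<in> carrier R" if "y \<in> A" for y using kF that by auto
  have eq: "vec_tensor S_mod A k s = s \<odot>\<^bsub>FS\<^esub> base_vec k"
    using s kA by (auto simp: vec_tensor_def base_vec_def \<phi>.S.m_comm intro!: restrict_ext)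
  have "base_endo B (vec_tensor S_mod A k s) = vec_tensor S_mod A k s" if "B \<in> rel_endos" "B k = k" for B
    using mod_homD(3)[OF base_endo_hom[OF that(1)] s base_vec_closed[OF kF]]
      base_endo_base_vec[OF that(1) kF] that(2) unfolding eq by simp
  then show ?case using gen(1) by (intro exI[of _ "{k}"]) auto
next
  case (add u v)
  obtain U where U: "finite U \<and> U \<subseteq> relations \<and> (\<forall>B\<in>rel_endos. (\<forall>v\<in>U. B v = v) \<longrightarrow> base_endo B u = u)"
    using add.IH(1) by (rule exE)
  obtain V where V: "finite V \<and> V \<subseteq> relations \<and> (\<forall>B\<in>rel_endos. (\<forall>v\<in>V. B v = v) \<longrightarrow> base_endo B v = v)"
    using add.IH(2) by (rule exE)
  have uv: "u \<in> carrier FS" "v \<in> carrier FS"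
    using relation_span_closed[OF S_mod_module] add(1,2) by simp_all
  have eq: "u \<oplus>\<^bsub>vec_module A S_mod\<^esub> v = u \<oplus>\<^bsub>FS\<^esub> v" by simp
  have fixed: "base_endo B (u \<oplus>\<^bsub>FS\<^esub> v) = u \<oplus>\<^bsub>FS\<^esub> v" if B: "B \<in> rel_endos" "\<forall>x\<in>U \<union> V. B x = x" for B
  proof -
    have "base_endo B u = u" "base_endo B v = v" using U V B by blast+
    then show ?thesis using mod_homD(2)[OF base_endo_hom[OF B(1)] uv] by (simp only:)
  qed
  have "finite (U \<union> V)" "U \<union> V \<subseteq> relations" using U V by auto
  then show ?case unfolding eq
    by (intro exI[of _ "U \<union> V"] conjI ballI impI) (assumption+, rule fixed)
qed

text \<open>The kernel of \<open>S\<^sup>A \<rightarrow> M \<otimes> S\<close> is the image of the projection \<open>z \<mapsto> z - h z\<close>, hence generated by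
  finitely many relations of \<open>M\<close>.\<close>

lemma exists_base_split:
  assumes h: "h \<in> mod_hom S T FS" "\<And>y. y \<in> carrier T \<Longrightarrow> lincomb T A base_gen (h y) = y"
  shows "\<exists>B\<in>rel_endos. \<forall>w\<in>relations. base_vec (B w) = base_vec w"
proof -
  let ?k = "lincomb T A base_gen"
  note k = lincomb_base_gen_hom
  \<comment> \<open>Since \<open>?k\<close> after \<open>h\<close> is the identity,
    \<open>?D\<close> is the projection of \<open>S^A\<close> onto the kernel of
    \<open>?k\<close>.\<close>
  let ?D = "\<lambda>z. z \<ominus>\<^bsub>FS\<^esub> h (?k z)"
  have idh: "(\<lambda>z. z) \<in> mod_hom S FS FS" by (rule mod_homI) (assumption | rule refl)+
  have D: "?D \<in> mod_hom S FS FS"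
    by (rule FSFS.mod_hom_minus_fun[OF idh mod_hom_comp[OF k h(1)]])
  have Dspan: "?D z \<in> relation_span S_mod" if z: "z \<in> carrier FS" for z
  proof (rule lincomb_base_gen_kernel)
    have kz: "?k z \<in> carrier T" by (rule mod_homD(1)[OF k z])
    have hk: "h (?k z) \<in> carrier FS" by (rule mod_homD(1)[OF h(1) kz])
    show "?D z \<in> carrier FS" by (rule mod_homD(1)[OF D z])
    show "?k (?D z) = \<zero>\<^bsub>T\<^esub>"
      using FST.mod_hom_diff[OF k z hk] h(2)[OF kz] T.r_neg[OF kz] by (simp only: a_minus_def)
  qed
  have ue: "unit_vec S A x \<in> carrier FS" for x using unit_vec_closed[OF S_cring] by simp
  \<comment> \<open>The kernel is spanned by the images under \<open>?D\<close> of the unit vectors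
    indexed by the finite set \<open>A\<close>, so a finite union of the sets \<open>V x\<close>
    suffices.\<close>
  have "\<forall>x. \<exists>V. finite V \<and> V \<subseteq> relations \<and>
      (\<forall>B\<in>rel_endos. (\<forall>v\<in>V. B v = v) \<longrightarrow> base_endo B (?D (unit_vec S A x)) = ?D (unit_vec S A x))"
    by (rule allI, rule relation_span_fixed[OF Dspan[OF ue]])
  then obtain V where V: "\<forall>x. finite (V x) \<and> V x \<subseteq> relations \<and>
      (\<forall>B\<in>rel_endos. (\<forall>v\<in>V x. B v = v) \<longrightarrow> base_endo B (?D (unit_vec S A x)) = ?D (unit_vec S A x))"
    by (rule choice[THEN exE])
  have "\<exists>B\<in>rel_endos. \<forall>v\<in>(\<Union>x\<in>A. V x). B v = v"
    using fin V by (intro finite_relations_fixed) auto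
  then obtain B where B: "B \<in> rel_endos" "\<And>x v. x \<in> A \<Longrightarrow> v \<in> V x \<Longrightarrow> B v = v" by blast
  have BD: "base_endo B (?D z) = ?D z" if "z \<in> carrier FS" for z
  proof (rule FS.mod_hom_free_module_cong[OF fin mod_hom_comp[OF D base_endo_hom[OF B(1)]] D])
    show "base_endo B (?D (unit_vec S A x)) = ?D (unit_vec S A x)" if "x \<in> A" for x
    proof -
      have "\<forall>v\<in>V x. B v = v" using B(2)[OF that] by (rule ballI)
      with V B(1) show ?thesis by (elim allE[of _ x] conjE ballE[of _ _ B] impE) simp_all
    qed
  qed (use that in simp)
  have "base_vec (B w) = base_vec w" if w: "w \<in> relations" for w
  proof -
    have wF: "w \<in> carrier F" and bw: "base_vec w \<in> carrier FS"
      using relations_closed[OF w] base_vec_closed by blast+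
    \<comment> \<open>A relation becomes zero in the base change, so \<open>?D\<close> fixes
      \<open>base_vec w\<close>; as \<open>base_endo B\<close> is the identity on the image of
      \<open>?D\<close>, it fixes this vector too.\<close>
    have "?D (base_vec w) = base_vec w \<ominus>\<^bsub>FS\<^esub> \<zero>\<^bsub>FS\<^esub>"
      using lincomb_base_gen_relation[OF w] TFS.mod_hom_zero[OF h(1)] by (simp only:)
    also have "\<dots> = base_vec w"
      using FS.minus_equality[OF FS.l_zero[OF FS.zero_closed] FS.zero_closed FS.zero_closed] FS.r_zero[OF bw]
      by (simp only: a_minus_def)
    finally show ?thesis using BD[OF bw] base_endo_base_vec[OF B(1) wF] by simp
  qed
  then show ?thesis using B(1) by blast
qed

text \<open>The coordinates of \<open>B w - w\<close> lie in the kernel of \<open>\<phi>\<close>,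
  which is contained in every prime contracted from \<open>S\<close>.\<close>

lemma splits_at_image:
  assumes B: "B \<in> rel_endos" "\<And>w. w \<in> relations \<Longrightarrow> base_vec (B w) = base_vec w"
    and q: "primeideal q S"
  shows "splits_at B (spec_map R S \<phi> q)"
  unfolding splits_at_def
proof (intro ballI)
  fix w x assume w: "w \<in> relations" and x: "x \<in> A"
  interpret q: primeideal q S by (rule q)
  have wF: "w \<in> carrier F" "B w \<in> carrier F" using relations_closed[OF w] rel_endosD(3)[OF B(1)] by auto
  have c: "w x \<in> carrier R" "B w x \<in> carrier R" using wF x by auto
  have "\<phi> (B w x) = \<phi> (w x)" using fun_cong[OF B(2)[OF w], of x] x by (simp add: base_vec_def)
  then have "\<phi> (B w x \<ominus> w x) = \<zero>\<^bsub>S\<^esub>" using c by (simp add: a_minus_def \<phi>.S.r_neg)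
  moreover have "\<zero>\<^bsub>S\<^esub> \<in> q" by (rule q.zero_closed)
  ultimately show "(B w \<ominus>\<^bsub>F\<^esub> w) x \<in> spec_map R S \<phi> q"
    using R.minus_closed[OF c(2,1)] by (simp only: spec_map_def minus_apply[OF wF(2,1) x] mem_Collect_eq simp_thms)
qed

end

theorem theorem3p20:
  fixes R :: "('r, 'a) ring_scheme" and S :: "('s, 'b) ring_scheme"
    and \<phi> :: "'r \<Rightarrow> 's" and M :: "('r, 'm, 'c) module_scheme"
  assumes "cring R" and "cring S" and "\<phi> \<in> ring_hom R S"
    and "module R M"
    and "finitely_generated_module R M"
    and "flat_module TYPE('r) TYPE('r) R M"
    and "\<exists>n\<ge>1. ideal_Inter R (iterated_cone R n (spec_map R S \<phi> ` Spec S)) \<subseteq> jacobson_radical R"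
    and "projective_module TYPE(('m, 's) tensor \<Rightarrow> 's) TYPE(('m, 's) tensor) S (base_change R S \<phi> M)"
  shows "projective_module TYPE('u) TYPE('v) R M"
proof -
  interpret M: module R M by fact
  obtain A where A: "finite A" "A \<subseteq> carrier M"
    and gens: "\<And>x. x \<in> carrier M \<Longrightarrow> \<exists>c\<in>A \<rightarrow> carrier R. x = (\<Oplus>\<^bsub>M\<^esub>a\<in>A. c a \<odot>\<^bsub>M\<^esub> a)"
    using assms(5) unfolding finitely_generated_module_def by blast
  interpret P: presentation R M A
  proof unfold_locales
    fix x assume "x \<in> carrier M"
    then obtain c where c: "c \<in> A \<rightarrow> carrier R" "x = (\<Oplus>\<^bsub>M\<^esub>a\<in>A. c a \<odot>\<^bsub>M\<^esub> a)" using gens by blast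
    \<comment> \<open>Elements of the free module are extensional functions, so the coefficients
      have to be restricted to \<open>A\<close>.\<close>
    have "lincomb M A (\<lambda>x. x) (restrict c A) = x"
      unfolding lincomb_def c(2) using c(1) A(2) by (intro M.finsum_cong') auto
    moreover have "restrict c A \<in> carrier (free_module R A)" using c(1) by auto
    ultimately show "\<exists>z\<in>carrier (free_module R A). lincomb M A (\<lambda>x. x) z = x" by blast
  qed (fact A)+
  \<comment> \<open>Flatness enters here, as purity of the relations.\<close>
  interpret base_change_presentation R M A S \<phi>
    by (intro base_change_presentation.intro pure_presentation.intro pure_presentation_axioms.intro
        base_change_presentation_axioms.intro P.presentation_axioms P.relation_fixed_if_flat assms)
  obtain h where "h \<in> mod_hom S T FS" "\<And>y. y \<in> carrier T \<Longrightarrow> lincomb T A base_gen (h y) = y"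
    using projective_module_section[OF assms(8) A(1) base_gen_closed lincomb_base_gen_onto] by blast
  from exists_base_split[OF this] obtain B where B: "B \<in> P.rel_endos"
    "\<And>w. w \<in> P.relations \<Longrightarrow> base_vec (B w) = base_vec w" by blast
  obtain n where "ideal_Inter R (iterated_cone R n (spec_map R S \<phi> ` Spec S)) \<subseteq> jacobson_radical R"
    using assms(7) by blast
  moreover have "P.splits_at B p" if "p \<in> spec_map R S \<phi> ` Spec S" for p
    using that splits_at_image[OF B] unfolding Spec_def by blast
  ultimately obtain B' where "B' \<in> P.rel_endos" "\<And>w. w \<in> P.relations \<Longrightarrow> B' w = w"
    using split_if_inter_subset_jacobson_radical[OF B(1)] by metis
  then show ?thesis by (rule P.projective_if_split)
qed

end
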